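(* Let $\epsilon_{3}^{1}\geq\epsilon_{3}^{2}$. If the rate vector $(R_{1},R_{2})$ is achievable, then $(R_{1},R_{2})\in\mathcal{R}$, where $\mathcal{R}$ is the set of pairs $(R_1,R_2)$ with $R_1\ge 0$, $R_2\ge 0$ for which there exist real numbers $G\geq0$, $S\geq0$, $U\geq0$ such that $$\frac{R_{1}}{1-\epsilon_{23}^{1}}+\frac{R_{2}}{1-\epsilon_{4}^{2}}\leq 1-G-S-U,$$ $$\left(\frac{\epsilon_{3}^{1}-\epsilon_{23}^{1}}{(1-\epsilon_{3}^{2})(1-\epsilon_{23}^{1})}+\frac{1}{1-\epsilon_{23}^{1}}\right)R_{1}+\frac{R_{2}}{1-\epsilon_{34}^{2}}\leq 1-G-S-U+\left(\frac{1-\epsilon_{3}^{1}}{1-\epsilon_{3}^{2}}\right)(G+S),$$ $$\left(\frac{\epsilon_{34}^{1}-\epsilon_{234}^{1}}{(1-\epsilon_{234}^{1})(1-\epsilon_{34}^{2})}+\frac{1}{1-\epsilon_{23}^{1}}\right)R_{1}+\frac{R_{2}}{1-\epsilon_{4}^{2}}\leq 1-G-S-U+\frac{1-\epsilon_{34}^{1}}{1-\epsilon_{34}^{2}}G+\frac{1-\epsilon_{4}^{1}}{1-\epsilon_{4}^{2}}(S+U).$$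
   Context: Network: there are four nodes; node 1 (primary transmitter) has a message for node 3, node 2 (secondary transmitter) has a message for node 4. Let $\mathcal{N}_1=\{2,3,4\}$, $\mathcal{N}_2=\{3,4\}$. Erasures are described by random tuples $\boldsymbol{Z}(t)=(\boldsymbol{Z}_1(t),\boldsymbol{Z}_2(t))$, $t=1,2,\dots$, with $\boldsymbol{Z}_i(t)=(Z_{ij}(t))_{j\in\mathcal{N}_i}$, $Z_{ij}(t)\in\{0,1\}$: a symbol transmitted by node $i$ at time $t$ is received by node $j\in\mathcal N_i$ if $Z_{ij}(t)=1$ and erased if $Z_{ij}(t)=0$. The tuples $\boldsymbol{Z}(t)$ are independent over $t$; for fixed $t$ the components may be arbitrarily dependent. For $\mathcal{S}\subseteq\mathcal{N}_i$, $\epsilon^i_{\mathcal{S}}=\Pr(Z_{ij}(t)=0\ \forall j\in\mathcal{S})$, which does not depend on $t$; e.g. $\epsilon_{23}^1=\epsilon^1_{\{2,3\}}$. It is assumed that $\epsilon^1_{23},\epsilon^2_3,\epsilon^2_4<1$. Scheduling and feedback: at each time $t\ge1$ exactly one node $\sigma(t)\in\{1,2\}$ transmits, and afterwards all nodes learn $\boldsymbol{Z}_{\sigma(t)}(t)$. Write $\boldsymbol{Z}^{t}=(\boldsymbol{Z}_{\sigma(s)}(s))_{s=1}^{t}$. $\sigma(1)$ is a fixed element, and $\sigma(t)=\sigma(\boldsymbol{Z}^{t-1})$ is a function of $\boldsymbol{Z}^{t-1}$ for $t\ge2$. Symbols ("packets") are elements of a finite field $\mathcal{F}$. $X_i(t)\in\mathcal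 F$ is the symbol transmitted by node $i$ at time $t$ ($X_i(t)=\eta$, a null symbol, if $\sigma(t)\ne i$). $Y_{ij}(t)$ is what node $j\in\mathcal{N}_i$ receives from node $i$ at time $t$: $X_i(t)$ if $\sigma(t)=i$ and $Z_{ij}(t)=1$, the erasure symbol $\varepsilon$ if $\sigma(t)=i$ and $Z_{ij}(t)=0$, and $\eta$ if $\sigma(t)\neq i$. For $\mathcal S\subseteq\mathcal N_i$, $\boldsymbol{Y}_{i\mathcal{S}}(t)=(Y_{ij}(t))_{j\in\mathcal{S}}$, and a superscript $t$ denotes the sequence over times $1,\dots,t$. Codes: a channel code $C_n$ of rate $\boldsymbol{R}=(R_1,R_2)$, $R_i\ge0$, uses $n$ transmissions and consists of: independent messages $\boldsymbol{W}_1,\boldsymbol{W}_2$, where $\boldsymbol{W}_i=(W_{i,1},\dots,W_{i,\lceil nR_i\rceil})$ has i.i.d. entries uniform on $\mathcal{F}$, independent of all $\boldsymbol{Z}(t)$; a scheduling rule $\sigma$; encoders: if $\sigma(t)=2$ then $X_2(t)=f_{2,n}(\boldsymbol{W}_2,\boldsymbol{Y}_{1\{2\}}^{t-1},\boldsymbol{Z}^{t-1})$ with $f_{2,n}$ arbitrary, and if $\sigma(t)=1$ then $X_1(t)=W_{1,J_n(t)}$, where the index $J_n(t)=J_n(\boldsymbol{Z}^{t-1})$ depends only on feedback ($J_n(1)$ is fixed); decoders $\hat{\boldsymbol{W}}_{j-2}=g_{j,n}(\boldsymbol{Y}_{1\{j\}}^n,\boldsymbol{Y}_{2\{j\}}^n,\boldsymbol{Z}^n)$,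 $j\in\{3,4\}$. The error probability is $\lambda_n=\Pr(\hat{\boldsymbol{W}}_1\ne\boldsymbol{W}_1\text{ or }\hat{\boldsymbol{W}}_2\neq\boldsymbol{W}_2)$. $\boldsymbol{R}$ is achievable if there is a sequence of codes $C_n$ of rate $\boldsymbol{R}$ with $\lim_{n\to\infty}\lambda_n=0$. *)

theory Defs
  imports "HOL-Probability.Probability"
begin

section \<open>Erasure process\<close>

definition nbrs :: "nat \<Rightarrow> nat set" where
  "nbrs i = (if i = 1 then {2, 3, 4} else if i = 2 then {3, 4} else {})"

definition links :: "(nat \<times> nat) set" where
  "links = Sigma {1, 2} nbrs"

text \<open>
  The value \<open>Z i j t \<omega>\<close> is \<open>True\<close> iff a symbol sent by node \<open>i\<close> at time \<open>t\<close> is received by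
  node \<open>j\<close>. The tuples over all links are independent over the times \<open>t \<ge> 1\<close>; within one time
  slot any dependence is allowed. Stationarity is only required of the numbers \<open>\<epsilon> i S\<close>,
  not of the joint law of the outputs of both transmitters.
\<close>

locale erasure_network = prob_space M
  for M :: "'w measure" +
  fixes Z :: "nat \<Rightarrow> nat \<Rightarrow> nat \<Rightarrow> 'w \<Rightarrow> bool"
    and \<epsilon> :: "nat \<Rightarrow> nat set \<Rightarrow> real"
  assumes indep_over_time:
      "indep_vars (\<lambda>_. Pi\<^sub>M links (\<lambda>_. count_space UNIV))
         (\<lambda>t \<omega>. \<lambda>(i, j)\<in>links. Z i j t \<omega>) {1..}"
    and erasure_prob:
      "\<lbrakk>t \<ge> 1; i \<in> {1, 2}; S \<subseteq> nbrs i\<rbrakk>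
         \<Longrightarrow> \<epsilon> i S = prob {\<omega> \<in> space M. \<forall>j\<in>S. \<not> Z i j t \<omega>}"


section \<open>Codes\<close>

datatype 'f symbol = Packet 'f | Erased | Null

text \<open>
  A feedback item is the tuple \<open>(Z i j t)\<close> for \<open>j \<in> nbrs i\<close>, where \<open>i\<close> is the transmitting
  node; it is stored as a function that is \<open>undefined\<close> outside \<open>nbrs i\<close>.
\<close>

type_synonym feedback = "(nat \<Rightarrow> bool) list"

text \<open>
  All maps of a code take the feedback sequence available so far. The current time is one more
  than its length, so no separate time argument is needed. Message entries are numbered from 1.
  The arguments of the decoders are what the receiver got from node 1, what it got from node 2,
  and the whole feedback sequence.
\<close>

record 'f code =
  sched :: "feedback \<Rightarrow> nat"
  index1 :: "feedback \<Rightarrow> nat"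
  enc2 :: "'f list \<Rightarrow> 'f symbol list \<Rightarrow> feedback \<Rightarrow> 'f"
  dec3 :: "'f symbol list \<Rightarrow> 'f symbol list \<Rightarrow> feedback \<Rightarrow> 'f list"
  dec4 :: "'f symbol list \<Rightarrow> 'f symbol list \<Rightarrow> feedback \<Rightarrow> 'f list"

text \<open>Below, \<open>z i j t\<close> is a realization of the erasure process.\<close>

primrec feedback_upto :: "'f code \<Rightarrow> (nat \<Rightarrow> nat \<Rightarrow> nat \<Rightarrow> bool) \<Rightarrow> nat \<Rightarrow> feedback" where
  "feedback_upto c z 0 = []"
| "feedback_upto c z (Suc t) =
     (let h = feedback_upto c z t; i = sched c h in h @ [\<lambda>j\<in>nbrs i. z i j (Suc t)])"

definition active :: "'f code \<Rightarrow> (nat \<Rightarrow> nat \<Rightarrow> nat \<Rightarrow> bool) \<Rightarrow> nat \<Rightarrow> nat" where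
  "active c z t = sched c (feedback_upto c z (t - 1))"

definition channel ::
  "'f code \<Rightarrow> (nat \<Rightarrow> nat \<Rightarrow> nat \<Rightarrow> bool) \<Rightarrow> (nat \<Rightarrow> 'f symbol) \<Rightarrow> nat \<Rightarrow> nat \<Rightarrow> nat \<Rightarrow> 'f symbol" where
  "channel c z X i j t =
     (if active c z t \<noteq> i then Null else if z i j t then X t else Erased)"

definition X1 :: "'f code \<Rightarrow> 'f list \<Rightarrow> (nat \<Rightarrow> nat \<Rightarrow> nat \<Rightarrow> bool) \<Rightarrow> nat \<Rightarrow> 'f symbol" where
  "X1 c w1 z t =
     (if active c z t = 1 then Packet (w1 ! (index1 c (feedback_upto c z (t - 1)) - 1)) else Null)"

definition Y1 :: "'f code \<Rightarrow> 'f list \<Rightarrow> (nat \<Rightarrow> nat \<Rightarrow> nat \<Rightarrow> bool) \<Rightarrow> nat \<Rightarrow> nat \<Rightarrow> 'f symbol" where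
  "Y1 c w1 z j t = channel c z (X1 c w1 z) 1 j t"

definition X2 ::
  "'f code \<Rightarrow> 'f list \<Rightarrow> 'f list \<Rightarrow> (nat \<Rightarrow> nat \<Rightarrow> nat \<Rightarrow> bool) \<Rightarrow> nat \<Rightarrow> 'f symbol" where
  "X2 c w1 w2 z t =
     (if active c z t = 2
      then Packet (enc2 c w2 (map (Y1 c w1 z 2) [1..<t]) (feedback_upto c z (t - 1))) else Null)"

definition Y2 ::
  "'f code \<Rightarrow> 'f list \<Rightarrow> 'f list \<Rightarrow> (nat \<Rightarrow> nat \<Rightarrow> nat \<Rightarrow> bool) \<Rightarrow> nat \<Rightarrow> nat \<Rightarrow> 'f symbol" where
  "Y2 c w1 w2 z j t = channel c z (X2 c w1 w2 z) 2 j t"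

definition decoding_error ::
  "nat \<Rightarrow> 'f code \<Rightarrow> 'f list \<Rightarrow> 'f list \<Rightarrow> (nat \<Rightarrow> nat \<Rightarrow> nat \<Rightarrow> bool) \<Rightarrow> bool" where
  "decoding_error n c w1 w2 z \<longleftrightarrow>
     dec3 c (map (Y1 c w1 z 3) [1..<n+1]) (map (Y2 c w1 w2 z 3) [1..<n+1])
       (feedback_upto c z n) \<noteq> w1
   \<or> dec4 c (map (Y1 c w1 z 4) [1..<n+1]) (map (Y2 c w1 w2 z 4) [1..<n+1])
       (feedback_upto c z n) \<noteq> w2"

definition msg_len :: "nat \<Rightarrow> real \<Rightarrow> nat" where
  "msg_len n R = nat \<lceil>real n * R\<rceil>"

text \<open>
  If \<open>R1 = 0\<close> then node 1 has no packets, and the condition on \<open>index1\<close> forces that it is never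
  scheduled.
\<close>

definition is_code :: "nat \<Rightarrow> real \<Rightarrow> 'f code \<Rightarrow> bool" where
  "is_code n R1 c \<longleftrightarrow>
     (\<forall>z. \<forall>t\<in>{1..n}. active c z t \<in> {1, 2} \<and>
        (active c z t = 1 \<longrightarrow>
           index1 c (feedback_upto c z (t - 1)) \<in> {1..msg_len n R1}))"

text \<open>
  The messages live on a product space, hence they are independent of each other and of the
  erasure process; their entries are i.i.d. uniform.
\<close>

definition messages :: "nat \<Rightarrow> real \<Rightarrow> real \<Rightarrow> ('f::finite list \<times> 'f list) pmf" where
  "messages n R1 R2 =
     pair_pmf (replicate_pmf (msg_len n R1) (pmf_of_set UNIV))
              (replicate_pmf (msg_len n R2) (pmf_of_set UNIV))"

definition error_prob ::
  "'w measure \<Rightarrow> (nat \<Rightarrow> nat \<Rightarrow> nat \<Rightarrow> 'w \<Rightarrow> bool) \<Rightarrow> nat \<Rightarrow> real \<Rightarrow> real \<Rightarrow> 'f::finite code \<Rightarrow> real"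
  where
  "error_prob M Z n R1 R2 c =
     measure (M \<Otimes>\<^sub>M measure_pmf (messages n R1 R2))
       {(\<omega>, (w1, w2)) | \<omega> w1 w2.
          \<omega> \<in> space M \<and> decoding_error n c w1 w2 (\<lambda>i j t. Z i j t \<omega>)}"

text \<open>The type argument is the finite field from which the packets are taken.\<close>

definition achievable ::
  "'f::{finite, field} itself \<Rightarrow> 'w measure \<Rightarrow> (nat \<Rightarrow> nat \<Rightarrow> nat \<Rightarrow> 'w \<Rightarrow> bool)
     \<Rightarrow> real \<Rightarrow> real \<Rightarrow> bool" where
  "achievable TYPE('f) M Z R1 R2 \<longleftrightarrow>
     R1 \<ge> 0 \<and> R2 \<ge> 0 \<and>
     (\<exists>C :: nat \<Rightarrow> 'f code.
        (\<forall>n. is_code n R1 (C n)) \<and>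
        (\<lambda>n. error_prob M Z n R1 R2 (C n)) \<longlonglongrightarrow> 0)"


section \<open>Outer region\<close>

definition outer_region :: "(nat \<Rightarrow> nat set \<Rightarrow> real) \<Rightarrow> (real \<times> real) set" where
  "outer_region \<epsilon> = {(R1, R2). R1 \<ge> 0 \<and> R2 \<ge> 0 \<and>
     (\<exists>G S U :: real. G \<ge> 0 \<and> S \<ge> 0 \<and> U \<ge> 0 \<and>
        R1 / (1 - \<epsilon> 1 {2,3}) + R2 / (1 - \<epsilon> 2 {4}) \<le> 1 - G - S - U \<and>
        ((\<epsilon> 1 {3} - \<epsilon> 1 {2,3}) / ((1 - \<epsilon> 2 {3}) * (1 - \<epsilon> 1 {2,3})) + 1 / (1 - \<epsilon> 1 {2,3})) * R1
          + R2 / (1 - \<epsilon> 2 {3,4})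
          \<le> 1 - G - S - U + ((1 - \<epsilon> 1 {3}) / (1 - \<epsilon> 2 {3})) * (G + S) \<and>
        ((\<epsilon> 1 {3,4} - \<epsilon> 1 {2,3,4}) / ((1 - \<epsilon> 1 {2,3,4}) * (1 - \<epsilon> 2 {3,4}))
            + 1 / (1 - \<epsilon> 1 {2,3})) * R1
          + R2 / (1 - \<epsilon> 2 {4})
          \<le> 1 - G - S - U + (1 - \<epsilon> 1 {3,4}) / (1 - \<epsilon> 2 {3,4}) * G
             + (1 - \<epsilon> 1 {4}) / (1 - \<epsilon> 2 {4}) * (S + U))}"

end

theory Submission
  imports Defs
begin

text \<open>
  Fix a realization of the erasures. The messages are uniform on a finite set, and everything sent or
  received is a function on that set, so entropies (to base \<open>|F|\<close>) are counting quantities. Let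
  \<open>h S V t\<close> be the entropy of the symbol sent at time \<open>t\<close> given \<open>V\<close> and all that the receivers in \<open>S\<close>
  have jointly got before. It depends on the past erasures only, so in expectation a transmission of
  node \<open>i\<close> contributes \<open>1 - \<epsilon> i S\<close> times \<open>h\<close> to the entropy of what \<open>S\<close> gets. Three bounds arise from
  decoding \<open>w2\<close> at node 4 given \<open>w1\<close>, from decoding \<open>w1\<close> at node 3 and then \<open>w2\<close> at \<open>{3, 4}\<close>, and from
  decoding \<open>w2\<close> at node 4 and then \<open>w1\<close> at \<open>{3, 4}\<close>; passing from one receiver to \<open>{3, 4}\<close> uses that
  \<open>h\<close> is antitone in \<open>S\<close>. Because node 1 sends uncoded packets, a packet that node 2 has not received
  is independent of all node 2 sends, so \<open>h S snd t = 1\<close> when \<open>2 \<in> S\<close> and the packet is new to \<open>S\<close>, and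
  \<open>h = 0\<close> when it is not; this gives the expected number of such transmissions. The transmissions of
  packets already received by node 2 or 3 are divided into \<open>G\<close>, \<open>S\<close>, \<open>U\<close>. A limit point of the
  normalized expected counts satisfies the inequalities of the region.
\<close>

section \<open>Entropy of functions on a finite uniform space\<close>

locale uniform_source =
  fixes b :: real and A :: "'x set"
  assumes fin: "finite A" and nonempty: "A \<noteq> {}" and base: "b \<ge> 2"
begin

definition fiber :: "('x \<Rightarrow> 'b) \<Rightarrow> 'x \<Rightarrow> real" where
  "fiber f x = real (card {y \<in> A. f y = f x})"

text \<open>Shannon entropy of \<open>f\<close> under the uniform law on \<open>A\<close>. Averaging
  over the points of \<open>A\<close> instead of over values avoids a distribution on the
  codomain.\<close>

definition ent :: "('x \<Rightarrow> 'b) \<Rightarrow> real" where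
  "ent f = (\<Sum>x\<in>A. log b (card A / fiber f x)) / card A"

definition cond_ent :: "('x \<Rightarrow> 'b) \<Rightarrow> ('x \<Rightarrow> 'c) \<Rightarrow> real" where
  "cond_ent f g = ent (\<lambda>x. (f x, g x)) - ent g"

definition determines :: "('x \<Rightarrow> 'b) \<Rightarrow> ('x \<Rightarrow> 'c) \<Rightarrow> bool" where
  "determines g f \<longleftrightarrow> (\<forall>x\<in>A. \<forall>y\<in>A. g x = g y \<longrightarrow> f x = f y)"

lemma card_pos: "0 < card A"
  using fin nonempty by (simp add: card_gt_0_iff)

lemma fiber_pos: "x \<in> A \<Longrightarrow> 0 < fiber f x"
  unfolding fiber_def using fin by (auto simp: card_gt_0_iff)

text \<open>The weight of a value is spread evenly over its fiber. This links the pointwise averages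
  in \<open>ent\<close> with sums over values.\<close>

lemma sum_div_fiber: "(\<Sum>x\<in>A. r (f x) / fiber f x) = (\<Sum>v\<in>f ` A. r v)"
proof -
  have "(\<Sum>x\<in>A. r (f x) / fiber f x) = (\<Sum>v\<in>f ` A. \<Sum>x | x \<in> A \<and> f x = v. r (f x) / fiber f x)"
    by (rule sum.image_gen[OF fin])
  also have "\<dots> = (\<Sum>v\<in>f ` A. r v)"
  proof (rule sum.cong[OF refl])
    fix v assume v: "v \<in> f ` A"
    have "(\<Sum>x | x \<in> A \<and> f x = v. r (f x) / fiber f x) =
        (\<Sum>x | x \<in> A \<and> f x = v. r v / real (card {y \<in> A. f y = v}))"
      by (rule sum.cong) (auto simp: fiber_def)
    also have "\<dots> = r v"
      using v fin by (auto simp: card_gt_0_iff)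
    finally show "(\<Sum>x | x \<in> A \<and> f x = v. r (f x) / fiber f x) = r v" .
  qed
  finally show ?thesis .
qed

text \<open>Nonnegativity of relative entropy, from \<open>ln x \<le> x - 1\<close>. Since
  \<open>r\<close> may be any positive subprobability on the values, each choice of \<open>r\<close>
  yields an upper bound for \<open>ent f\<close>.\<close>

lemma gibbs:
  assumes pos: "\<And>v. v \<in> f ` A \<Longrightarrow> 0 < r v" and le: "(\<Sum>v\<in>f ` A. r v) \<le> 1"
  shows "ent f \<le> (\<Sum>x\<in>A. - log b (r (f x))) / card A"
proof -
  have "(\<Sum>x\<in>A. log b (card A / fiber f x) - (- log b (r (f x)))) \<le>
      (\<Sum>x\<in>A. (card A * (r (f x) / fiber f x) - 1) / ln b)"
  proof (rule sum_mono)
    fix x assume x: "x \<in> A"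
    have p: "0 < real (card A)" "0 < fiber f x" "0 < r (f x)"
      using card_pos fiber_pos[OF x] pos x by auto
    have "log b (card A / fiber f x) - (- log b (r (f x))) = ln (card A * (r (f x) / fiber f x)) / ln b"
      using p by (simp add: log_def ln_mult ln_div add_divide_distrib diff_divide_distrib)
    also have "\<dots> \<le> (card A * (r (f x) / fiber f x) - 1) / ln b"
      using p base by (intro divide_right_mono ln_le_minus_one) auto
    finally show "log b (card A / fiber f x) - (- log b (r (f x))) \<le>
      (card A * (r (f x) / fiber f x) - 1) / ln b" .
  qed
  also have "\<dots> = (card A * (\<Sum>x\<in>A. r (f x) / fiber f x) - card A) / ln b"
    by (simp add: sum_divide_distrib[symmetric] sum_subtractf sum_distrib_left)
  also have "\<dots> \<le> 0"
  proof -
    have "card A * (\<Sum>x\<in>A. r (f x) / fiber f x) \<le> real (card A) * 1"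
      unfolding sum_div_fiber using le by (intro mult_left_mono) auto
    then show ?thesis using base by (intro divide_nonpos_pos) auto
  qed
  finally show ?thesis
    unfolding ent_def by (intro divide_right_mono) (auto simp: sum_subtractf sum.distrib sum_negf)
qed

lemma ent_le_log_card:
  assumes "card (f ` A) \<le> m"
  shows "ent f \<le> log b m"
proof -
  have c: "0 < card (f ` A)" using fin nonempty by (simp add: card_gt_0_iff)
  have "ent f \<le> (\<Sum>x\<in>A. - log b (1 / m)) / card A"
    using c assms by (intro gibbs) (auto simp: field_simps)
  also have "\<dots> = log b m"
    using card_pos c assms base by (simp add: log_divide)
  finally show ?thesis .
qed

lemma ent_mono:
  assumes "determines g f"
  shows "ent f \<le> ent g"
proof -
  have "log b (card A / fiber f x) \<le> log b (card A / fiber g x)" if x: "x \<in> A" for x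
  proof -
  have "fiber g x \<le> fiber f x"
    unfolding fiber_def using assms x fin
    by (intro of_nat_mono card_mono) (simp, unfold determines_def, blast)
  then have "card A / fiber f x \<le> card A / fiber g x"
    using fiber_pos[OF x, of g] by (intro divide_left_mono) auto
  then show "log b (card A / fiber f x) \<le> log b (card A / fiber g x)"
    using fiber_pos[OF x, of f] fiber_pos[OF x, of g] card_pos base
    by (intro log_mono) auto
  qed
  then show ?thesis
    unfolding ent_def by (intro divide_right_mono sum_mono) auto
qed

lemma ent_cong:
  assumes "\<And>x y. x \<in> A \<Longrightarrow> y \<in> A \<Longrightarrow> f x = f y \<longleftrightarrow> g x = g y"
  shows "ent f = ent g"
proof (rule antisym)
  show "ent f \<le> ent g" "ent g \<le> ent f"
    using assms by (intro ent_mono; unfold determines_def; blast)+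
qed

lemma ent_uniform_fibers:
  assumes "\<And>x. x \<in> A \<Longrightarrow> fiber f x = m"
  shows "ent f = log b (card A / m)"
  unfolding ent_def using assms card_pos by simp

lemma ent_inj: "inj_on f A \<Longrightarrow> ent f = log b (card A)"
proof -
  assume "inj_on f A"
  then have "{y \<in> A. f y = f x} = {x}" if "x \<in> A" for x
    using that by (auto simp: inj_on_def)
  then show ?thesis using ent_uniform_fibers[of f 1] by (simp add: fiber_def)
qed

lemma ent_const: "ent (\<lambda>_. k) = 0"
  using ent_uniform_fibers[of "\<lambda>_. k" "card A"] card_pos by (simp add: fiber_def)

section \<open>Submodularity, conditional entropy and Fano's inequality\<close>

lemma sum_fiber_pair: "(\<Sum>u\<in>f ` A. real (card {y \<in> A. f y = u \<and> g y = v})) = real (card {y \<in> A. g y = v})"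
  using sum.group[of "{y \<in> A. g y = v}" "f ` A" f "\<lambda>_. 1::real"] fin
  by (simp add: conj_commute conj_left_commute image_mono)

text \<open>\<open>gibbs\<close> for the law under which \<open>f\<close> and \<open>h\<close> are
  conditionally independent given \<open>g\<close>, with the true laws of \<open>(f, g)\<close> and
  \<open>(h, g)\<close>.\<close>

lemma ent_submodular:
  "ent (\<lambda>x. (f x, g x, h x)) + ent g \<le> ent (\<lambda>x. (f x, g x)) + ent (\<lambda>x. (h x, g x))"
proof -
  define nf where "nf u v = real (card {y \<in> A. f y = u \<and> g y = v})" for u v
  define nh where "nh w v = real (card {y \<in> A. h y = w \<and> g y = v})" for w v
  define ng where "ng v = real (card {y \<in> A. g y = v})" for v
  define r where "r = (\<lambda>(u, v, w). nf u v * nh w v / (ng v * card A))"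
  let ?F = "\<lambda>x. (f x, g x, h x)"
  have e: "fiber (\<lambda>x. (f x, g x)) x = nf (f x) (g x)" "fiber (\<lambda>x. (h x, g x)) x = nh (h x) (g x)"
    "fiber g x = ng (g x)" for x
    by (simp_all add: fiber_def nf_def nh_def ng_def)
  have p: "0 < nf (f x) (g x)" "0 < nh (h x) (g x)" "0 < ng (g x)" "0 < real (card A)" if "x \<in> A" for x
    using fiber_pos[OF that, of "\<lambda>x. (f x, g x)"] fiber_pos[OF that, of "\<lambda>x. (h x, g x)"]
      fiber_pos[OF that, of g] e card_pos by auto
  have nn: "0 \<le> nf u v" "0 \<le> nh u' v" "0 \<le> ng v" for u u' v
    by (simp_all add: nf_def nh_def ng_def)
  \<comment> \<open>Adding the triples that do not occur makes the sum factor over \<open>f\<close>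
    and \<open>h\<close>; the enlarged sum is exactly 1.\<close>
  have "(\<Sum>v\<in>?F ` A. r v) \<le> (\<Sum>v\<in>f ` A \<times> g ` A \<times> h ` A. r v)"
    using fin nn by (intro sum_mono2) (auto simp: r_def intro!: divide_nonneg_nonneg mult_nonneg_nonneg)
  also have "\<dots> = (\<Sum>u\<in>f ` A. \<Sum>v\<in>g ` A. \<Sum>w\<in>h ` A. nf u v * nh w v / (ng v * card A))"
    by (simp add: r_def sum.cartesian_product)
  also have "\<dots> = (\<Sum>v\<in>g ` A. \<Sum>u\<in>f ` A. \<Sum>w\<in>h ` A. nf u v * nh w v / (ng v * card A))"
    by (rule sum.swap)
  also have "\<dots> = (\<Sum>v\<in>g ` A. (\<Sum>u\<in>f ` A. nf u v) * (\<Sum>w\<in>h ` A. nh w v) / (ng v * card A))"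
    by (simp add: sum_product sum_divide_distrib)
  also have "\<dots> = (\<Sum>v\<in>g ` A. ng v * ng v / (ng v * card A))"
    unfolding nf_def nh_def ng_def sum_fiber_pair ..
  also have "\<dots> = (\<Sum>v\<in>g ` A. ng v) / card A"
    unfolding sum_divide_distrib using p by (intro sum.cong) auto
  also have "\<dots> = 1"
    using sum_fiber_pair[of g "\<lambda>_. ()" "()"] card_pos by (simp add: ng_def)
  finally have "ent ?F \<le> (\<Sum>x\<in>A. - log b (r (?F x))) / card A"
    using card_pos by (intro gibbs) (auto simp: r_def p intro!: divide_pos_pos mult_pos_pos)
  also have "(\<Sum>x\<in>A. - log b (r (?F x))) =
     (\<Sum>x\<in>A. log b (card A / nf (f x) (g x)) + log b (card A / nh (h x) (g x)) - log b (card A / ng (g x)))"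
  proof (rule sum.cong[OF refl])
    fix x assume "x \<in> A"
    note q = p[OF this] p[OF this, THEN less_imp_neq, symmetric]
    show "- log b (r (?F x)) = log b (card A / nf (f x) (g x)) + log b (card A / nh (h x) (g x)) - log b (card A / ng (g x))"
      using q by (simp add: r_def log_def ln_mult ln_div diff_divide_distrib add_divide_distrib)
  qed
  also have "\<dots> / card A = ent (\<lambda>x. (f x, g x)) + ent (\<lambda>x. (h x, g x)) - ent g"
    by (simp add: ent_def e sum.distrib sum_subtractf add_divide_distrib diff_divide_distrib)
  finally show ?thesis by simp
qed

lemma cond_ent_nonneg: "0 \<le> cond_ent f g"
  unfolding cond_ent_def using ent_mono[of "\<lambda>x. (f x, g x)" g] by (simp add: determines_def)

lemma cond_ent_eq_0:
  assumes "determines g f"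
  shows "cond_ent f g = 0"
proof -
  have "ent (\<lambda>x. (f x, g x)) = ent g"
    using assms unfolding determines_def prod.inject by (intro ent_cong) blast
  then show ?thesis by (simp add: cond_ent_def)
qed

lemma cond_ent_antimono:
  assumes "determines g' g"
  shows "cond_ent f g' \<le> cond_ent f g"
proof -
  have g: "g x = g y" if "x \<in> A" "y \<in> A" "g' x = g' y" for x y
    using assms that unfolding determines_def by blast
  have "ent (\<lambda>x. (f x, g x, g' x)) = ent (\<lambda>x. (f x, g' x))" "ent (\<lambda>x. (g' x, g x)) = ent g'"
    unfolding prod.inject by (rule ent_cong, unfold prod.inject, use g in blast)+
  then show ?thesis
    using ent_submodular[of f g g'] by (simp add: cond_ent_def)
qed

lemma cond_ent_le_ent: "cond_ent f g \<le> ent f"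
proof -
  have "cond_ent f g \<le> cond_ent f (\<lambda>_. ())"
    by (rule cond_ent_antimono) (auto simp: determines_def)
  also have "\<dots> = ent f"
    by (auto simp: cond_ent_def ent_const intro!: ent_cong)
  finally show ?thesis .
qed

text \<open>The error indicator costs at most one unit because \<open>log b 2 \<le> 1\<close>; that
  unit vanishes later, on division by the block length.\<close>

lemma fano:
  assumes "card (f ` A) \<le> m"
  shows "cond_ent f g \<le> 1 + card {x \<in> A. d (g x) \<noteq> f x} / card A * log b m"
proof -
  \<comment> \<open>The value \<open>e x\<close> reveals \<open>f x\<close> only when the guess
    \<open>d (g x)\<close> is wrong, so \<open>e\<close> and \<open>g\<close> together determine
    \<open>f\<close>.\<close>
  define e where "e x = (if d (g x) = f x then None else Some (f x))" for x
  \<comment> \<open>Half of the mass lies on a correct guess, and the other half is shared by at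
    most \<open>m\<close> values.\<close>
  define r where "r v = (case v of None \<Rightarrow> 1 / 2 | Some _ \<Rightarrow> 1 / (2 * real m))" for v :: "'a option"
  have m: "0 < m" using assms fin nonempty by (metis card_gt_0_iff finite_imageI gr0I image_is_empty le_zero_eq not_gr_zero)
  have "cond_ent f g \<le> cond_ent e g"
    unfolding cond_ent_def by (simp, rule ent_mono) (auto simp: determines_def e_def split: if_splits)
  also have "\<dots> \<le> ent e"
    by (rule cond_ent_le_ent)
  also have "\<dots> \<le> (\<Sum>x\<in>A. - log b (r (e x))) / card A"
  proof (rule gibbs)
    have "sum r (e ` A) \<le> sum r (insert None (Some ` f ` A))"
      using fin m by (intro sum_mono2) (auto simp: e_def r_def split: option.splits)
    also have "\<dots> = 1 / 2 + (\<Sum>v\<in>f ` A. 1 / (2 * real m))"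
      using fin by (subst sum.insert) (auto simp: r_def sum.reindex)
    also have "\<dots> \<le> 1"
      using assms m by (simp add: field_simps)
    finally show "sum r (e ` A) \<le> 1" .
  qed (use m in \<open>auto simp: r_def split: option.splits\<close>)
  also have "(\<Sum>x\<in>A. - log b (r (e x))) =
      (\<Sum>x\<in>A. log b 2 + (if d (g x) \<noteq> f x then log b m else 0))"
    using m base by (intro sum.cong refl) (simp add: r_def e_def log_divide log_mult)
  also have "\<dots> = card A * log b 2 + card {x \<in> A. d (g x) \<noteq> f x} * log b m"
    using fin by (simp add: sum.distrib sum.If_cases Int_def)
  also have "\<dots> / card A = log b 2 + card {x \<in> A. d (g x) \<noteq> f x} / card A * log b m"
    using card_pos by (simp add: add_divide_distrib)
  also have "log b 2 \<le> 1"
    using base by simp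
  finally show ?thesis by simp
qed

end

section \<open>Knowledge of the receivers for a fixed realization\<close>

type_synonym realization = "nat \<Rightarrow> nat \<Rightarrow> nat \<Rightarrow> bool"

section \<open>Causality: dependence on past erasures only\<close>

text \<open>Only genuine links are compared, so a quantity invariant under \<open>agree t\<close> is
  a function of finitely many erasure bits. Measurability and independence are derived from
  this.\<close>

definition agree :: "nat \<Rightarrow> realization \<Rightarrow> realization \<Rightarrow> bool" where
  "agree t z z' \<longleftrightarrow> (\<forall>s\<in>{1..t}. \<forall>(i, j)\<in>links. z i j s = z' i j s)"

lemma agree_mono: "agree t z z' \<Longrightarrow> s \<le> t \<Longrightarrow> agree s z z'"
  unfolding agree_def by fastforce

lemma agreeD: "agree t z z' \<Longrightarrow> 1 \<le> s \<Longrightarrow> s \<le> t \<Longrightarrow> j \<in> nbrs i \<Longrightarrow> z i j s = z' i j s"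
  unfolding agree_def links_def by (fastforce simp: nbrs_def split: if_splits)

lemma feedback_upto_agree: "agree t z z' \<Longrightarrow> feedback_upto c z t = feedback_upto c z' t"
proof (induction t)
  case (Suc t)
  then have "feedback_upto c z t = feedback_upto c z' t"
    using agree_mono by fastforce
  moreover have "(\<lambda>j\<in>nbrs i. z i j (Suc t)) = (\<lambda>j\<in>nbrs i. z' i j (Suc t))" for i
    using agreeD[OF Suc.prems] by (intro restrict_ext) auto
  ultimately show ?case by (simp add: Let_def)
qed simp

lemma active_agree: "agree (t - 1) z z' \<Longrightarrow> active c z t = active c z' t"
  unfolding active_def using feedback_upto_agree by metis

text \<open>The intersection with \<open>nbrs\<close> lets \<open>S\<close> contain node 2 even in
  slots where node 2 itself transmits.\<close>

definition heard :: "'f code \<Rightarrow> realization \<Rightarrow> nat set \<Rightarrow> nat \<Rightarrow> bool" where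
  "heard c z S t \<longleftrightarrow> (\<exists>j\<in>S \<inter> nbrs (active c z t). z (active c z t) j t)"

text \<open>Message entries are numbered from 1, list positions from 0.\<close>

definition packet :: "'f code \<Rightarrow> realization \<Rightarrow> nat \<Rightarrow> nat" where
  "packet c z t = index1 c (feedback_upto c z (t - 1)) - 1"

definition sent :: "'f code \<Rightarrow> realization \<Rightarrow> nat \<Rightarrow> 'f list \<times> 'f list \<Rightarrow> 'f" where
  "sent c z t w = (if active c z t = 1 then fst w ! packet c z t
     else enc2 c (snd w) (map (Y1 c (fst w) z 2) [1..<t]) (feedback_upto c z (t - 1)))"

text \<open>With the erasures fixed, the joint record of \<open>S\<close> is a function of the
  messages alone. A new slot changes only one entry of it.\<close>

definition know :: "'f code \<Rightarrow> realization \<Rightarrow> nat set \<Rightarrow> nat \<Rightarrow> 'f list \<times> 'f list \<Rightarrow> nat \<Rightarrow> 'f option" where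
  "know c z S t w = (\<lambda>s. if s \<in> {1..t} \<and> heard c z S s then Some (sent c z s w) else None)"

text \<open>Only uncoded reception strictly before \<open>t\<close> counts; a packet learnt through
  the coded symbols of node 2 is not included.\<close>

definition got :: "'f code \<Rightarrow> realization \<Rightarrow> nat set \<Rightarrow> nat \<Rightarrow> nat \<Rightarrow> bool" where
  "got c z S p t \<longleftrightarrow> (\<exists>s\<in>{1..<t}. active c z s = 1 \<and> packet c z s = p \<and> heard c z S s)"

lemma heard_mono: "S \<subseteq> S' \<Longrightarrow> heard c z S t \<Longrightarrow> heard c z S' t"
  unfolding heard_def by blast

lemma got_mono: "S \<subseteq> S' \<Longrightarrow> got c z S p t \<Longrightarrow> got c z S' p t"
  unfolding got_def using heard_mono by blast

lemma heard_Un: "heard c z (S \<union> S') t \<longleftrightarrow> heard c z S t \<or> heard c z S' t"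
  unfolding heard_def by blast

lemma got_Un: "got c z (S \<union> S') p t \<longleftrightarrow> got c z S p t \<or> got c z S' p t"
  unfolding got_def heard_Un by blast

lemma packet_agree: "agree (t - 1) z z' \<Longrightarrow> packet c z t = packet c z' t"
  unfolding packet_def using feedback_upto_agree by metis

lemma heard_agree: "agree t z z' \<Longrightarrow> 1 \<le> t \<Longrightarrow> heard c z S t = heard c z' S t"
  using active_agree[of t z z' c] agree_mono[of t z z' "t - 1"] agreeD[of t z z' t]
  unfolding heard_def by auto

lemma got_agree:
  assumes a: "agree (t - 1) z z'"
  shows "got c z S p t = got c z' S p t"
proof -
  have "active c z s = active c z' s" "packet c z s = packet c z' s" "heard c z S s = heard c z' S s"
    if "s \<in> {1..<t}" for s
    using agree_mono[OF a, of s] agree_mono[OF a, of "s - 1"] that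
    by (auto intro!: active_agree packet_agree heard_agree)
  then show ?thesis unfolding got_def by auto
qed

lemma Y1_agree:
  assumes a: "agree s z z'" and s: "1 \<le> s" and j: "j \<in> nbrs 1"
  shows "Y1 c w1 z j s = Y1 c w1 z' j s"
  using active_agree[OF agree_mono[OF a], of s c] feedback_upto_agree[OF agree_mono[OF a], of "s - 1" c]
    agreeD[OF a s _ j]
  by (simp add: Y1_def channel_def X1_def)

lemma Y1_map_agree:
  assumes a: "agree (t - 1) z z'" and j: "j \<in> nbrs 1"
  shows "map (Y1 c w1 z j) [1..<t] = map (Y1 c w1 z' j) [1..<t]"
  using agree_mono[OF a] by (intro map_cong refl Y1_agree j) auto

text \<open>Schedule, packet index and the inputs of node 2 use slots before \<open>t\<close> only,
  so the erasures of slot \<open>t\<close> do not influence the symbol. This strict causality later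
  lets the factor \<open>1 - \<epsilon> i S\<close> be split off.\<close>

lemma sent_agree:
  assumes a: "agree (t - 1) z z'"
  shows "sent c z t = sent c z' t"
proof -
  have "map (Y1 c w1 z 2) [1..<t] = map (Y1 c w1 z' 2) [1..<t]" for w1
    using a by (rule Y1_map_agree) (simp add: nbrs_def)
  then show ?thesis
    unfolding sent_def active_agree[OF a] packet_agree[OF a] feedback_upto_agree[OF a] by presburger
qed

lemma know_agree:
  assumes a: "agree t z z'"
  shows "know c z S t = know c z' S t"
proof -
  have "sent c z s = sent c z' s" "heard c z S s = heard c z' S s" if "s \<in> {1..t}" for s
    using agree_mono[OF a, of s] agree_mono[OF a, of "s - 1"] that
    by (auto intro!: sent_agree heard_agree)
  then show ?thesis unfolding know_def by (auto intro!: ext)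
qed

lemma X1_eq_sent: "active c z t = 1 \<Longrightarrow> X1 c (fst w) z t = Packet (sent c z t w)"
  by (simp add: X1_def sent_def packet_def)

lemma X2_eq_sent: "active c z t = 2 \<Longrightarrow> X2 c (fst w) (snd w) z t = Packet (sent c z t w)"
  by (simp add: X2_def sent_def)

lemma X2_agree: "agree (t - 1) z z' \<Longrightarrow> X2 c w1 w2 z t = X2 c w1 w2 z' t"
  using active_agree[of t z z' c] sent_agree[of t z z' c]
    X2_eq_sent[of c z t "(w1, w2)"] X2_eq_sent[of c z' t "(w1, w2)"]
  by (cases "active c z t = 2") (auto simp: X2_def)

lemma Y2_agree:
  assumes a: "agree s z z'" and s: "1 \<le> s" and j: "j \<in> nbrs 2"
  shows "Y2 c w1 w2 z j s = Y2 c w1 w2 z' j s"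
  using active_agree[OF agree_mono[OF a], of s c] X2_agree[OF agree_mono[OF a], of s c w1 w2]
    agreeD[OF a s _ j]
  by (simp add: Y2_def channel_def)

lemma decoding_error_agree:
  assumes a: "agree n z z'"
  shows "decoding_error n c w1 w2 z = decoding_error n c w1 w2 z'"
proof -
  have y1: "map (Y1 c w1 z j) [1..<n+1] = map (Y1 c w1 z' j) [1..<n+1]" if "j \<in> nbrs 1" for j
    using a that by (intro Y1_map_agree) auto
  have y2: "map (Y2 c w1 w2 z j) [1..<n+1] = map (Y2 c w1 w2 z' j) [1..<n+1]" if "j \<in> nbrs 2" for j
    using agree_mono[OF a] that by (intro map_cong refl Y2_agree) auto
  have j: "3 \<in> nbrs 1" "4 \<in> nbrs 1" "3 \<in> nbrs 2" "4 \<in> nbrs 2"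
    by (auto simp: nbrs_def)
  show ?thesis
    unfolding decoding_error_def feedback_upto_agree[OF a] y1[OF j(1)] y1[OF j(2)] y2[OF j(3)] y2[OF j(4)] ..
qed

text \<open>A slot in which node \<open>j\<close> receives the symbol is recorded in
  \<open>know\<close>; in every other slot the output is fixed by the realization.\<close>

lemma Y1_know:
  assumes k: "know c z S t w = know c z S t w'" and s: "s \<in> {1..t}" and j: "j \<in> S" "j \<in> nbrs 1"
  shows "Y1 c (fst w) z j s = Y1 c (fst w') z j s"
proof (cases "active c z s = 1 \<and> z 1 j s")
  case True
  then have "heard c z S s"
    using j by (auto simp: heard_def)
  then have "sent c z s w = sent c z s w'"
    using fun_cong[OF k, of s] s by (simp add: know_def)
  then show ?thesis
    using True by (simp add: Y1_def channel_def X1_eq_sent)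
qed (auto simp: Y1_def channel_def)

lemma Y2_know:
  assumes k: "know c z S t w = know c z S t w'" and s: "s \<in> {1..t}" and j: "j \<in> S" "j \<in> nbrs 2"
  shows "Y2 c (fst w) (snd w) z j s = Y2 c (fst w') (snd w') z j s"
proof (cases "active c z s = 2 \<and> z 2 j s")
  case True
  then have "heard c z S s"
    using j by (auto simp: heard_def)
  then have "sent c z s w = sent c z s w'"
    using fun_cong[OF k, of s] s by (simp add: know_def)
  then show ?thesis
    using True by (simp add: Y2_def channel_def X2_eq_sent)
qed (auto simp: Y2_def channel_def)

lemma know_eq_iff:
  "know c z S t w = know c z S t w' \<longleftrightarrow> (\<forall>s\<in>{1..t}. heard c z S s \<longrightarrow> sent c z s w = sent c z s w')"
  by (auto simp: know_def fun_eq_iff)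

section \<open>Entropy increments of a code of block length \<open>n\<close>\<close>

locale relay_code =
  fixes c :: "'f::{finite, field} code" and n L1 L2 :: nat
  assumes active_cases: "t \<in> {1..n} \<Longrightarrow> active c z t \<in> {1, 2}"
    and index_range: "\<lbrakk>t \<in> {1..n}; active c z t = 1\<rbrakk> \<Longrightarrow> index1 c (feedback_upto c z (t - 1)) \<in> {1..L1}"
begin

definition W :: "('f list \<times> 'f list) set" where
  "W = {w1. length w1 = L1} \<times> {w2. length w2 = L2}"

lemma finite_lists: "finite {w :: 'f list. length w = L}" "card {w :: 'f list. length w = L} = CARD('f) ^ L"
  using finite_lists_length_eq[of "UNIV :: 'f set" L] card_lists_length_eq[of "UNIV :: 'f set" L] by simp_all

lemma card_W: "card W = CARD('f) ^ (L1 + L2)"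
  by (simp add: W_def card_cartesian_product finite_lists power_add)

lemma two_le_card: "2 \<le> CARD('f)"
  using card_mono[of "UNIV :: 'f set" "{0, 1}"] by simp

sublocale uniform_source "real CARD('f)" W
proof
  show "finite W" by (simp add: W_def finite_lists)
  show "W \<noteq> {}" using card_W two_le_card by (metis card.empty power_not_zero not_numeral_le_zero)
  show "2 \<le> real CARD('f)" using two_le_card by simp
qed

text \<open>\<open>V\<close> is side information: constant, \<open>fst\<close> for revealing
  \<open>w1\<close>, or \<open>snd\<close> for revealing \<open>w2\<close>. The entropy is joint, so
  it includes \<open>ent V\<close>.\<close>

definition H :: "realization \<Rightarrow> nat set \<Rightarrow> ('f list \<times> 'f list \<Rightarrow> 'v) \<Rightarrow> nat \<Rightarrow> real" where
  "H z S V t = ent (\<lambda>w. (know c z S t w, V w))"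

definition h :: "realization \<Rightarrow> nat set \<Rightarrow> ('f list \<times> 'f list \<Rightarrow> 'v) \<Rightarrow> nat \<Rightarrow> real" where
  "h z S V t = cond_ent (sent c z t) (\<lambda>w. (know c z S (t - 1) w, V w))"

lemma H_0: "H z S V 0 = ent V"
  unfolding H_def by (rule ent_cong) (simp add: know_def)

text \<open>Chain rule. The factor from the current erasures is kept apart from \<open>h\<close>,
  which depends on the past ones only.\<close>

lemma H_Suc: "H z S V (Suc t) = H z S V t + of_bool (heard c z S (Suc t)) * h z S V (Suc t)"
proof (cases "heard c z S (Suc t)")
  case True
  have "H z S V (Suc t) = ent (\<lambda>w. (sent c z (Suc t) w, know c z S t w, V w))"
    unfolding H_def by (rule ent_cong) (use True in \<open>auto simp: know_eq_iff atLeastAtMostSuc_conv\<close>)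
  then show ?thesis using True by (simp add: H_def h_def cond_ent_def)
next
  case False
  have "H z S V (Suc t) = H z S V t"
    unfolding H_def by (rule ent_cong) (use False in \<open>auto simp: know_eq_iff atLeastAtMostSuc_conv\<close>)
  then show ?thesis using False by simp
qed

lemma H_eq_sum: "H z S V t = ent V + (\<Sum>s=1..t. of_bool (heard c z S s) * h z S V s)"
  by (induction t) (simp_all add: H_0 H_Suc)

lemma H_agree: "agree t z z' \<Longrightarrow> H z S V t = H z' S V t"
  unfolding H_def by (simp add: know_agree)

lemma h_agree: "agree (t - 1) z z' \<Longrightarrow> h z S V t = h z' S V t"
  unfolding h_def using know_agree[of "t - 1" z z' c S] sent_agree[of t z z' c] by simp

lemma h_nonneg: "0 \<le> h z S V t"
  unfolding h_def by (rule cond_ent_nonneg)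

lemma h_le_1: "h z S V t \<le> 1"
proof -
  have "h z S V t \<le> ent (sent c z t)"
    unfolding h_def by (rule cond_ent_le_ent)
  also have "\<dots> \<le> log (real CARD('f)) CARD('f)"
    by (intro ent_le_log_card card_mono) auto
  also have "\<dots> = 1"
    using base by simp
  finally show ?thesis .
qed

lemma h_antimono:
  assumes "S \<subseteq> S'" and V: "determines V' V"
  shows "h z S' V' t \<le> h z S V t"
proof -
  have "V x = V y" if "x \<in> W" "y \<in> W" "V' x = V' y" for x y
    using V that unfolding determines_def by blast
  then show ?thesis
    unfolding h_def using heard_mono[OF assms(1)]
    by (intro cond_ent_antimono) (unfold determines_def prod.inject know_eq_iff, blast)
qed

lemma determines_refl: "determines V V"
  by (simp add: determines_def)

lemma h_eq_0_if_got:
  assumes a: "active c z t = 1" and g: "got c z S (packet c z t) t"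
  shows "h z S V t = 0"
proof -
  obtain s where s: "s \<in> {1..t-1}" "active c z s = 1" "packet c z s = packet c z t" "heard c z S s"
    using g unfolding got_def by fastforce
  have "sent c z t w = sent c z s w" for w
    using a s by (simp add: sent_def)
  then show ?thesis
    unfolding h_def using s by (intro cond_ent_eq_0) (auto simp: determines_def know_eq_iff)
qed

lemma h_fst_eq_0: "active c z t = 1 \<Longrightarrow> h z S fst t = 0"
  unfolding h_def by (rule cond_ent_eq_0) (simp add: determines_def sent_def)

text \<open>Node 2 encodes from \<open>w2\<close> and from what it heard itself, and both are
  available to a set containing node 2.\<close>

lemma h_snd_eq_0:
  assumes "active c z t = 2" "2 \<in> S"
  shows "h z S snd t = 0"
proof -
  have "sent c z t w = sent c z t w'"
    if "know c z S (t - 1) w = know c z S (t - 1) w'" "snd w = snd w'" for w w'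
  proof -
    have "map (Y1 c (fst w) z 2) [1..<t] = map (Y1 c (fst w') z 2) [1..<t]"
      using that assms by (intro map_cong refl Y1_know[where S = S and t = "t - 1"]) (auto simp: nbrs_def)
    then show ?thesis
      unfolding sent_def that(2) assms(1) by presburger
  qed
  then show ?thesis
    unfolding h_def by (intro cond_ent_eq_0) (unfold determines_def prod.inject, blast)
qed

lemma ent_fst: "ent fst = L1"
proof -
  have "fiber fst w = CARD('f) ^ L2" if "w \<in> W" for w
  proof -
    have "{v \<in> W. fst v = fst w} = {fst w} \<times> {w2. length w2 = L2}"
      using that by (auto simp: W_def)
    then show ?thesis by (simp add: fiber_def card_cartesian_product finite_lists)
  qed
  then have "ent fst = log (real CARD('f)) (card W / (CARD('f) ^ L2))"
    by (rule ent_uniform_fibers)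
  then show ?thesis using base by (simp add: card_W power_add log_nat_power)
qed

lemma ent_snd: "ent snd = L2"
proof -
  have "fiber snd w = CARD('f) ^ L1" if "w \<in> W" for w
  proof -
    have "{v \<in> W. snd v = snd w} = {w1. length w1 = L1} \<times> {snd w}"
      using that by (auto simp: W_def)
    then show ?thesis by (simp add: fiber_def card_cartesian_product finite_lists)
  qed
  then have "ent snd = log (real CARD('f)) (card W / (CARD('f) ^ L1))"
    by (rule ent_uniform_fibers)
  then show ?thesis using base by (simp add: card_W power_add log_nat_power)
qed

lemma ent_inj_on: "inj_on f W \<Longrightarrow> ent f = L1 + L2"
  using ent_inj[of f] base by (simp add: card_W log_nat_power)

lemma ent_le: "ent f \<le> L1 + L2"
  using ent_mono[of id f] ent_inj_on[of id] by (simp add: determines_def)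

lemma packet_less: "t \<in> {1..n} \<Longrightarrow> active c z t = 1 \<Longrightarrow> packet c z t < L1"
  using index_range[of t z] by (auto simp: packet_def)

text \<open>
  Everything node 2 can influence is a function of \<open>w2\<close> and of the entries of \<open>w1\<close> it has received,
  so an entry it has not received is still uniform given all the others.
\<close>

lemma h_eq_1_if_not_got:
  assumes t: "t \<in> {1..n}" and a: "active c z t = 1" and S: "2 \<in> S"
    and g: "\<not> got c z S (packet c z t) t"
  shows "h z S snd t = 1"
proof -
  define p where "p = packet c z t"
  \<comment> \<open>All message entries except entry \<open>p\<close> of \<open>w1\<close>; the 0 is
    only a placeholder.\<close>
  define rest where "rest w = ((fst w)[p := 0], snd w)" for w :: "'f list \<times> 'f list"
  have p: "p < L1"
    using packet_less[OF t a] by (simp add: p_def)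
  have ent_rest: "ent rest = L1 + L2 - 1"
  proof -
    have "fiber rest w = CARD('f)" if w: "w \<in> W" for w
    proof -
      have "{v \<in> W. rest v = rest w} = (\<lambda>x. ((fst w)[p := x], snd w)) ` UNIV"
      proof (intro set_eqI iffI)
        fix v assume "v \<in> {v \<in> W. rest v = rest w}"
        then have v: "v \<in> W" "(fst v)[p := 0] = (fst w)[p := 0]" "snd v = snd w"
          by (auto simp: rest_def)
        then have "fst v = (fst w)[p := fst v ! p]"
          by (metis list_update_id list_update_overwrite)
        then show "v \<in> range (\<lambda>x. ((fst w)[p := x], snd w))"
          using v(3) by (metis prod.collapse rangeI)
      qed (use w in \<open>auto simp: W_def rest_def\<close>)
      moreover have "inj (\<lambda>x. ((fst w)[p := x], snd w))"
      proof (rule injI)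
        fix x y assume "((fst w)[p := x], snd w) = ((fst w)[p := y], snd w)"
        then have "(fst w)[p := x] ! p = (fst w)[p := y] ! p" by simp
        then show "x = y" using p w by (auto simp: W_def)
      qed
      ultimately show ?thesis by (simp add: fiber_def card_image)
    qed
    then have "ent rest = log (real CARD('f)) (card W / CARD('f))"
      by (rule ent_uniform_fibers)
    also have "\<dots> = L1 + L2 - 1"
      using base p by (simp add: card_W log_divide log_nat_power)
    finally show ?thesis .
  qed
  \<comment> \<open>Slots of node 1 that \<open>S\<close> did not hear are excluded, since they may
    carry \<open>p\<close>. Slots of node 2 need no such restriction: node 2 belongs to
    \<open>S\<close> and thus has not received \<open>p\<close> either.\<close>
  have sent_eq: "sent c z s w = sent c z s w'"
    if r: "rest w = rest w'" and s: "s \<in> {1..t-1}" and hs: "heard c z S s \<or> active c z s \<noteq> 1" for s w w'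
  proof -
    have nth: "fst w ! packet c z u = fst w' ! packet c z u" if u: "u \<in> {1..<t}" "active c z u = 1" "heard c z S u" for u
    proof -
      have "packet c z u \<noteq> p"
        using g u by (auto simp: got_def p_def)
      then show ?thesis
        using r unfolding rest_def by (metis nth_list_update_neq prod.inject)
    qed
    show ?thesis
    proof (cases "active c z s = 1")
      case True
      then show ?thesis using nth[of s] s hs by (auto simp: sent_def)
    next
      case False
      have "Y1 c (fst w) z 2 u = Y1 c (fst w') z 2 u" if "u \<in> {1..<s}" for u
      proof (cases "active c z u = 1 \<and> z 1 2 u")
        case True
        then have "heard c z S u" using S by (auto simp: heard_def nbrs_def)
        moreover have "u \<in> {1..<t}" using that s by auto
        ultimately have "sent c z u w = sent c z u w'"
          using nth[of u] True by (simp add: sent_def)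
        then show ?thesis using True by (simp add: Y1_def channel_def X1_eq_sent)
      qed (auto simp: Y1_def channel_def)
      then have "map (Y1 c (fst w) z 2) [1..<s] = map (Y1 c (fst w') z 2) [1..<s]"
        by (intro map_cong) auto
      moreover have "snd w = snd w'"
        using r by (simp add: rest_def)
      ultimately show ?thesis using False unfolding sent_def by presburger
    qed
  qed
  have rest_snd: "rest w = rest w' \<Longrightarrow> snd w = snd w'" for w w'
    by (simp add: rest_def)
  have "determines rest (\<lambda>w. (know c z S (t - 1) w, snd w))"
    unfolding determines_def know_eq_iff prod.inject using sent_eq rest_snd by blast
  then have "cond_ent (sent c z t) rest \<le> h z S snd t"
    unfolding h_def by (rule cond_ent_antimono)
  \<comment> \<open>The sent symbol restores the entry removed in \<open>rest\<close>, so both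
    together determine the whole message pair.\<close>
  moreover have "cond_ent (sent c z t) rest = 1"
  proof -
    have "inj_on (\<lambda>w. (sent c z t w, rest w)) W"
    proof (rule inj_onI)
      fix v w assume "(sent c z t v, rest v) = (sent c z t w, rest w)"
      then have v: "fst v ! p = fst w ! p" "(fst v)[p := 0] = (fst w)[p := 0]" "snd v = snd w"
        using a by (auto simp: sent_def rest_def p_def)
      then have "fst v = fst w"
        by (metis list_update_id list_update_overwrite)
      then show "v = w" using v(3) by (simp add: prod_eq_iff)
    qed
    from ent_inj_on[OF this] show ?thesis
      using ent_rest p by (simp add: cond_ent_def)
  qed
  ultimately show ?thesis using h_le_1[of z S snd t] by simp
qed

section \<open>Fano bounds for the two decoders\<close>

text \<open>The error probability conditional on the erasures; \<open>mean_err\<close> shows that it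
  averages to \<open>error_prob\<close>.\<close>

definition err :: "realization \<Rightarrow> real" where
  "err z = card {w \<in> W. decoding_error n c (fst w) (snd w) z} / card W"

lemma err_agree: "agree n z z' \<Longrightarrow> err z = err z'"
  unfolding err_def by (simp add: decoding_error_agree[of n z z' c])

lemma err_nonneg: "0 \<le> err z"
  by (simp add: err_def)

lemma fano_decoder:
  fixes D f :: "'f list \<times> 'f list \<Rightarrow> 'f list"
  assumes D: "\<And>w w'. know c z S n w = know c z S n w' \<Longrightarrow> D w = D w'"
    and err: "\<And>w. w \<in> W \<Longrightarrow> D w \<noteq> f w \<Longrightarrow> decoding_error n c (fst w) (snd w) z"
    and L: "f ` W \<subseteq> {w. length w = L}"
  shows "ent (\<lambda>w. (f w, know c z S n w, V w)) \<le> H z S V n + (1 + err z * L)"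
proof -
  \<comment> \<open>The decoder output is turned into a function of the knowledge by picking any
    message pair with that knowledge; \<open>D\<close> does not depend on the choice.\<close>
  define d where "d k = D (SOME w. know c z S n w = k)" for k
  have d: "d (know c z S n w) = D w" for w
    unfolding d_def by (rule D) (rule someI, rule refl)
  have "cond_ent f (\<lambda>w. (know c z S n w, V w)) \<le> cond_ent f (know c z S n)"
    by (rule cond_ent_antimono) (unfold determines_def prod.inject, blast)
  also have "\<dots> \<le> 1 + card {w \<in> W. d (know c z S n w) \<noteq> f w} / card W * log (real CARD('f)) (real (CARD('f) ^ L))"
    using card_mono[OF finite_lists(1) L] by (intro fano) (simp add: finite_lists(2))
  also have "log (real CARD('f)) (real (CARD('f) ^ L)) = L"
    using base by (simp add: log_nat_power)
  also have "card {w \<in> W. d (know c z S n w) \<noteq> f w} / card W * real L \<le> err z * L"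
    unfolding err_def d using err fin
    by (intro mult_right_mono divide_right_mono of_nat_mono card_mono) auto
  finally show ?thesis by (simp add: cond_ent_def H_def)
qed

lemma fano3:
  assumes S: "3 \<in> S"
  shows "ent (\<lambda>w. (fst w, know c z S n w, V w)) \<le> H z S V n + (1 + err z * L1)"
proof (rule fano_decoder[where D = "\<lambda>w. dec3 c (map (Y1 c (fst w) z 3) [1..<n+1])
      (map (Y2 c (fst w) (snd w) z 3) [1..<n+1]) (feedback_upto c z n)"])
  fix w w' assume k: "know c z S n w = know c z S n w'"
  have "map (Y1 c (fst w) z 3) [1..<n+1] = map (Y1 c (fst w') z 3) [1..<n+1]"
    "map (Y2 c (fst w) (snd w) z 3) [1..<n+1] = map (Y2 c (fst w') (snd w') z 3) [1..<n+1]"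
    by (intro map_cong refl Y1_know[OF k] Y2_know[OF k]; use S in \<open>force simp: nbrs_def\<close>)+
  then show "dec3 c (map (Y1 c (fst w) z 3) [1..<n+1]) (map (Y2 c (fst w) (snd w) z 3) [1..<n+1]) (feedback_upto c z n)
     = dec3 c (map (Y1 c (fst w') z 3) [1..<n+1]) (map (Y2 c (fst w') (snd w') z 3) [1..<n+1]) (feedback_upto c z n)"
    by presburger
qed (auto simp: decoding_error_def W_def)

lemma fano4:
  assumes S: "4 \<in> S"
  shows "ent (\<lambda>w. (snd w, know c z S n w, V w)) \<le> H z S V n + (1 + err z * L2)"
proof (rule fano_decoder[where D = "\<lambda>w. dec4 c (map (Y1 c (fst w) z 4) [1..<n+1])
      (map (Y2 c (fst w) (snd w) z 4) [1..<n+1]) (feedback_upto c z n)"])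
  fix w w' assume k: "know c z S n w = know c z S n w'"
  have "map (Y1 c (fst w) z 4) [1..<n+1] = map (Y1 c (fst w') z 4) [1..<n+1]"
    "map (Y2 c (fst w) (snd w) z 4) [1..<n+1] = map (Y2 c (fst w') (snd w') z 4) [1..<n+1]"
    by (intro map_cong refl Y1_know[OF k] Y2_know[OF k]; use S in \<open>force simp: nbrs_def\<close>)+
  then show "dec4 c (map (Y1 c (fst w) z 4) [1..<n+1]) (map (Y2 c (fst w) (snd w) z 4) [1..<n+1]) (feedback_upto c z n)
     = dec4 c (map (Y1 c (fst w') z 4) [1..<n+1]) (map (Y2 c (fst w') (snd w') z 4) [1..<n+1]) (feedback_upto c z n)"
    by presburger
qed (auto simp: decoding_error_def W_def)

text \<open>Node 3 can decode \<open>w1\<close>, so revealing it after \<open>n\<close> slots adds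
  no more than the Fano term.\<close>

lemma H_fst_le: "3 \<in> S \<Longrightarrow> H z S fst n \<le> H z S (\<lambda>_. ()) n + (1 + err z * L1)"
  using fano3[of S z "\<lambda>_. ()"]
    ent_mono[of "\<lambda>w. (fst w, know c z S n w, ())" "\<lambda>w. (know c z S n w, fst w)"]
  by (simp add: H_def determines_def)

lemma H_snd_le: "4 \<in> S \<Longrightarrow> H z S snd n \<le> H z S (\<lambda>_. ()) n + (1 + err z * L2)"
  using fano4[of S z "\<lambda>_. ()"]
    ent_mono[of "\<lambda>w. (snd w, know c z S n w, ())" "\<lambda>w. (know c z S n w, snd w)"]
  by (simp add: H_def determines_def)

text \<open>Once node 3 has decoded \<open>w1\<close>, knowing \<open>w2\<close> as well leaves no
  uncertainty, hence full entropy up to the Fano term.\<close>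

lemma le_H_snd: "3 \<in> S \<Longrightarrow> L1 + L2 \<le> H z S snd n + (1 + err z * L1)"
  using fano3[of S z snd]
  by (subst (asm) ent_inj_on) (auto simp: inj_on_def)

lemma le_H_fst: "4 \<in> S \<Longrightarrow> L1 + L2 \<le> H z S fst n + (1 + err z * L2)"
  using fano4[of S z fst]
  by (subst (asm) ent_inj_on) (auto simp: inj_on_def)

lemma H_le: "H z S V n \<le> L1 + L2"
  unfolding H_def by (rule ent_le)

text \<open>
  The expected totals of \<open>gain\<close>, \<open>side\<close> and \<open>useless\<close> become the variables \<open>G\<close>, \<open>S\<close> and \<open>U\<close> of the
  region. They cannot be plain counts of packet states: a packet never received directly by node 4 may
  have reached it in a combination with \<open>w2\<close>. Hence \<open>gain\<close> and \<open>side\<close> are weighted by the entropy of the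
  packet given \<open>w2\<close> and all that nodes 3 and 4 have got.
\<close>

definition new :: "realization \<Rightarrow> nat set \<Rightarrow> nat \<Rightarrow> real" where
  "new z S t = of_bool (active c z t = 1 \<and> \<not> got c z S (packet c z t) t)"

definition gain :: "realization \<Rightarrow> nat \<Rightarrow> real" where
  "gain z t = of_bool (active c z t = 1 \<and> got c z {2, 3} (packet c z t) t) * h z {3, 4} snd t"

definition side :: "realization \<Rightarrow> nat \<Rightarrow> real" where
  "side z t = of_bool (active c z t = 1 \<and> got c z {2, 3} (packet c z t) t \<and> \<not> got c z {3} (packet c z t) t)
     * (1 - h z {3, 4} snd t)"

definition useless :: "realization \<Rightarrow> nat \<Rightarrow> real" where
  "useless z t = of_bool (active c z t = 1 \<and> got c z {3} (packet c z t) t)"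

section \<open>Slotwise bounds for the transmissions of node 1\<close>

lemma gain_side_useless_nonneg: "0 \<le> gain z t" "0 \<le> side z t" "0 \<le> useless z t"
  using h_nonneg[of z "{3, 4}" snd t] h_le_1[of z "{3, 4}" snd t]
  by (auto simp: gain_def side_def useless_def)

lemma got_3: "got c z {3} p t \<Longrightarrow> got c z {2, 3} p t" "got c z {3} p t \<Longrightarrow> got c z {3, 4} p t"
  by (auto elim: got_mono[rotated])

text \<open>For a packet held by node 2 but not by node 3, \<open>gain\<close> and
  \<open>side\<close> share the slot as \<open>h\<close> and \<open>1 - h\<close>. For a packet held
  by node 3, \<open>gain\<close> vanishes because \<open>h\<close> does.\<close>

lemma time_split:
  assumes t: "t \<in> {1..n}"
  shows "of_bool (active c z t = 2) + new z {2, 3} t + gain z t + side z t + useless z t = 1"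
  using active_cases[OF t, of z] got_3[of z "packet c z t" t]
    h_eq_0_if_got[of z t "{3, 4}" snd]
  by (auto simp: new_def gain_def side_def useless_def)

lemma h_3_le: "of_bool (active c z t = 1) * h z {3} V t \<le> new z {2, 3} t + gain z t + side z t"
  using h_eq_0_if_got[of z t "{3}" V] h_le_1[of z "{3}" V t] h_nonneg[of z "{3, 4}" snd t]
    h_le_1[of z "{3, 4}" snd t]
  by (auto simp: new_def gain_def side_def)

text \<open>Ignorance of \<open>w2\<close> can make a packet more informative for node 4 only if
  node 2 or 3 already got it, and such slots are paid for by \<open>side\<close> or
  \<open>useless\<close>.\<close>

lemma h_4_le:
  assumes t: "t \<in> {1..n}"
  shows "of_bool (active c z t = 1) * h z {4} (\<lambda>_. ()) t
     \<le> of_bool (active c z t = 1) * h z {4} snd t + side z t + useless z t"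
proof (cases "active c z t = 1")
  case a: True
  let ?p = "packet c z t"
  have mono: "h z {3, 4} snd t \<le> h z {4} snd t" "h z {2, 4} snd t \<le> h z {4} snd t"
    by (auto intro!: h_antimono simp: determines_refl)
  \<comment> \<open>In turn: \<open>useless\<close> is 1; \<open>side\<close> fills the gap below 1;
    node 4 already has the packet; the packet is uniform for node 4 even given
    \<open>w2\<close>.\<close>
  consider "got c z {3} ?p t" | "got c z {2, 3} ?p t" "\<not> got c z {3} ?p t" | "\<not> got c z {2} ?p t" "got c z {4} ?p t"
    | "\<not> got c z {2, 4} ?p t"
    using got_Un[of c z "{2}" "{3}" ?p t] got_Un[of c z "{2}" "{4}" ?p t] by (auto simp: insert_commute)
  then show ?thesis
  proof cases
    case 1
    then show ?thesis
      using a h_le_1[of z "{4}" "\<lambda>_. ()" t] h_nonneg[of z "{4}" snd t] gain_side_useless_nonneg(2)[of z t]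
      by (simp add: useless_def)
  next
    case 2
    then show ?thesis
      using a h_le_1[of z "{4}" "\<lambda>_. ()" t] mono by (simp add: useless_def side_def)
  next
    case 3
    then show ?thesis
      using a h_eq_0_if_got[OF a 3(2), of "\<lambda>_. ()"] h_nonneg[of z "{4}" snd t] gain_side_useless_nonneg(2,3)[of z t]
      by simp
  next
    case 4
    then show ?thesis
      using a h_eq_1_if_not_got[OF t a _ 4] mono h_le_1[of z "{4}" "\<lambda>_. ()" t] gain_side_useless_nonneg(2,3)[of z t]
      by simp
  qed
qed (use gain_side_useless_nonneg[of z t] in simp)

text \<open>A packet not yet held by node 2 or 3 is either held by node 4, with \<open>h\<close>
  zero, or new to all three nodes.\<close>

lemma h_34_le: "of_bool (active c z t = 1) * h z {3, 4} snd t \<le> new z {2, 3, 4} t + gain z t"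
  using h_eq_0_if_got[of z t "{3, 4}" snd] h_le_1[of z "{3, 4}" snd t] got_Un[of c z "{3, 4}" "{2}" "packet c z t" t]
    got_mono[of "{2}" "{2, 3}" c z "packet c z t" t]
  by (auto simp: new_def gain_def)

lemma h_snd_eq_new:
  assumes "t \<in> {1..n}" "2 \<in> S"
  shows "of_bool (active c z t = 1) * h z S snd t = new z S t"
  using h_eq_0_if_got[of z t S snd] h_eq_1_if_not_got[OF assms(1) _ assms(2), of z]
  by (auto simp: new_def)

end

section \<open>Averaging over the erasures\<close>

definition depends_upto :: "nat \<Rightarrow> (realization \<Rightarrow> real) \<Rightarrow> bool" where
  "depends_upto t \<phi> \<longleftrightarrow> (\<forall>z z'. agree t z z' \<longrightarrow> \<phi> z = \<phi> z')"

lemma depends_upto_const: "depends_upto t (\<lambda>_. k)"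
  by (simp add: depends_upto_def)

lemma depends_upto_add:
  "depends_upto t \<phi> \<Longrightarrow> depends_upto t \<psi> \<Longrightarrow> depends_upto t (\<lambda>z. \<phi> z + \<psi> z)"
  unfolding depends_upto_def by (intro allI impI arg_cong2[where f = "(+)"]) blast+

lemma depends_upto_mult_left: "depends_upto t \<phi> \<Longrightarrow> depends_upto t (\<lambda>z. \<phi> z * k)"
  unfolding depends_upto_def by (intro allI impI arg_cong2[where f = "(*)"]) blast+

lemma depends_upto_sum:
  "(\<And>i. i \<in> I \<Longrightarrow> depends_upto t (\<phi> i)) \<Longrightarrow> depends_upto t (\<lambda>z. \<Sum>i\<in>I. \<phi> i z)"
  unfolding depends_upto_def by (intro allI impI sum.cong refl) blast

lemma finite_links: "finite links"
  by (simp add: links_def nbrs_def)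

context erasure_network
begin

abbreviation slot :: "nat \<Rightarrow> 'w \<Rightarrow> nat \<times> nat \<Rightarrow> bool" where
  "slot t \<omega> \<equiv> \<lambda>(i, j)\<in>links. Z i j t \<omega>"

abbreviation slot_space :: "(nat \<times> nat \<Rightarrow> bool) measure" where
  "slot_space \<equiv> \<Pi>\<^sub>M _\<in>links. count_space UNIV"

definition realization_of :: "'w \<Rightarrow> realization" where
  "realization_of \<omega> = (\<lambda>i j t. Z i j t \<omega>)"

definition mean :: "(realization \<Rightarrow> real) \<Rightarrow> real" where
  "mean \<phi> = expectation (\<lambda>\<omega>. \<phi> (realization_of \<omega>))"

text \<open>Finitely many slots form a finite discrete space, on which every function is measurable
  and bounded.\<close>

lemma block_space:
  assumes "finite T"
  shows "(\<Pi>\<^sub>M _\<in>T. slot_space) = count_space (\<Pi>\<^sub>E _\<in>T. \<Pi>\<^sub>E _\<in>links. UNIV)"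
    and "finite (\<Pi>\<^sub>E _\<in>T. \<Pi>\<^sub>E _\<in>links. UNIV :: bool set)"
proof -
  have "finite (\<Pi>\<^sub>E _\<in>links. UNIV :: bool set)"
    using finite_links by (intro finite_PiE) auto
  moreover have "slot_space = count_space (\<Pi>\<^sub>E _\<in>links. UNIV)"
    by (rule count_space_PiM_finite) (simp_all add: finite_links)
  ultimately show "(\<Pi>\<^sub>M _\<in>T. slot_space) = count_space (\<Pi>\<^sub>E _\<in>T. \<Pi>\<^sub>E _\<in>links. UNIV)"
    "finite (\<Pi>\<^sub>E _\<in>T. \<Pi>\<^sub>E _\<in>links. UNIV :: bool set)"
    using assms by (simp_all add: count_space_PiM_finite countable_finite finite_PiE)
qed

lemma slot_measurable: "1 \<le> t \<Longrightarrow> slot t \<in> M \<rightarrow>\<^sub>M slot_space"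
  using indep_over_time unfolding indep_vars_def by simp

lemma block_measurable:
  assumes "finite T" "T \<subseteq> {1..}"
  shows "(\<lambda>\<omega>. \<lambda>t\<in>T. slot t \<omega>) \<in> M \<rightarrow>\<^sub>M (\<Pi>\<^sub>M _\<in>T. slot_space)"
  using assms by (intro measurable_restrict slot_measurable) auto

lemma depends_upto_factor:
  assumes "depends_upto t \<phi>"
  obtains \<psi> where "\<And>\<omega>. \<phi> (realization_of \<omega>) = \<psi> (\<lambda>s\<in>{1..t}. slot s \<omega>)"
proof
  fix \<omega>
  have "agree t (realization_of \<omega>) (\<lambda>i j s. (\<lambda>s\<in>{1..t}. slot s \<omega>) s (i, j))"
    by (auto simp: agree_def realization_of_def)
  then show "\<phi> (realization_of \<omega>) = (\<lambda>p. \<phi> (\<lambda>i j s. p s (i, j))) (\<lambda>s\<in>{1..t}. slot s \<omega>)"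
    using assms unfolding depends_upto_def by blast
qed

lemma integrable_depends_upto:
  assumes "depends_upto t \<phi>"
  shows "integrable M (\<lambda>\<omega>. \<phi> (realization_of \<omega>))"
proof -
  obtain \<psi> where \<psi>: "\<And>\<omega>. \<phi> (realization_of \<omega>) = \<psi> (\<lambda>s\<in>{1..t}. slot s \<omega>)"
    using depends_upto_factor[OF assms] by blast
  define A where "A = (\<Pi>\<^sub>E _\<in>{1..t}. \<Pi>\<^sub>E _\<in>links. UNIV :: bool set)"
  have A: "finite A" "(\<Pi>\<^sub>M _\<in>{1..t}. slot_space) = count_space A"
    unfolding A_def using block_space[of "{1..t}"] by auto
  have m: "(\<lambda>\<omega>. \<lambda>s\<in>{1..t}. slot s \<omega>) \<in> M \<rightarrow>\<^sub>M count_space A"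
    using block_measurable[of "{1..t}"] A(2) by auto
  have "(\<lambda>\<omega>. \<psi> (\<lambda>s\<in>{1..t}. slot s \<omega>)) \<in> borel_measurable M"
    by (rule measurable_compose[OF m]) simp
  moreover have "norm (\<psi> (\<lambda>s\<in>{1..t}. slot s \<omega>)) \<le> Max ((\<lambda>p. norm (\<psi> p)) ` A)" if "\<omega> \<in> space M" for \<omega>
    using A(1) measurable_space[OF m that] by (intro Max_ge) auto
  ultimately show ?thesis
    unfolding \<psi> by (intro integrable_const_bound[where B = "Max ((\<lambda>p. norm (\<psi> p)) ` A)"]) auto
qed

lemma mean_add: "depends_upto t \<phi> \<Longrightarrow> depends_upto t \<psi> \<Longrightarrow> mean (\<lambda>z. \<phi> z + \<psi> z) = mean \<phi> + mean \<psi>"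
  unfolding mean_def by (intro Bochner_Integration.integral_add integrable_depends_upto)

lemma mean_sum: "(\<And>i. i \<in> I \<Longrightarrow> depends_upto t (\<phi> i)) \<Longrightarrow> mean (\<lambda>z. \<Sum>i\<in>I. \<phi> i z) = (\<Sum>i\<in>I. mean (\<phi> i))"
  unfolding mean_def by (intro Bochner_Integration.integral_sum integrable_depends_upto)

lemma mean_mult: "mean (\<lambda>z. \<phi> z * k) = mean \<phi> * k"
  unfolding mean_def by simp

lemma mean_const: "mean (\<lambda>z. k) = k"
  unfolding mean_def by (simp add: prob_space)

lemma mean_mono:
  assumes "depends_upto t \<phi>" "depends_upto t \<psi>" "\<And>z. \<phi> z \<le> \<psi> z"
  shows "mean \<phi> \<le> mean \<psi>"
  unfolding mean_def using assms by (intro integral_mono integrable_depends_upto) auto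

lemma Z_measurable:
  assumes "1 \<le> t" "i \<in> {1, 2}" "j \<in> nbrs i"
  shows "Z i j t \<in> M \<rightarrow>\<^sub>M count_space UNIV"
proof -
  have l: "(i, j) \<in> links"
    using assms by (auto simp: links_def)
  from measurable_compose[OF slot_measurable[OF assms(1)] measurable_component_singleton[OF l]]
  show ?thesis using l by simp
qed

lemma all_erased_event:
  assumes t: "1 \<le> t" and i: "i \<in> {1, 2}" and S: "S \<subseteq> nbrs i"
  shows "{\<omega> \<in> space M. \<forall>j\<in>S. \<not> Z i j t \<omega>} \<in> events"
proof (rule sets.sets_Collect_finite_All)
  show "finite S" using S i finite_subset[of S "nbrs i"] by (auto simp: nbrs_def)
  fix j assume "j \<in> S"
  then have [measurable]: "Z i j t \<in> M \<rightarrow>\<^sub>M count_space UNIV"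
    using Z_measurable[OF t i] S by blast
  show "{\<omega> \<in> space M. \<not> Z i j t \<omega>} \<in> events" by measurable
qed

lemma eps_antimono:
  assumes "i \<in> {1, 2}" "S' \<subseteq> nbrs i" "S \<subseteq> S'"
  shows "\<epsilon> i S' \<le> \<epsilon> i S"
proof -
  have S: "S \<subseteq> nbrs i" using assms by blast
  show ?thesis
    unfolding erasure_prob[OF order_refl assms(1,2)] erasure_prob[OF order_refl assms(1) S]
    using assms by (intro finite_measure_mono all_erased_event S) auto
qed

text \<open>\<open>\<phi>\<close> reads the slots before \<open>t\<close> and the reception event
  reads slot \<open>t\<close>. These are disjoint blocks of an independent family, so the
  expectation factors whatever the dependence inside a slot.\<close>

lemma mean_mult_received:
  assumes \<phi>: "depends_upto (t - 1) \<phi>" and t: "1 \<le> t" and i: "i \<in> {1, 2}" and S: "S \<subseteq> nbrs i"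
  shows "mean (\<lambda>z. \<phi> z * of_bool (\<exists>j\<in>S. z i j t)) = (1 - \<epsilon> i S) * mean \<phi>"
proof -
  obtain \<psi> where \<psi>: "\<And>\<omega>. \<phi> (realization_of \<omega>) = \<psi> (\<lambda>s\<in>{1..t-1}. slot s \<omega>)"
    using depends_upto_factor[OF \<phi>] by blast
  define \<rho> where "\<rho> p = (of_bool (\<exists>j\<in>S. p t (i, j)) :: real)" for p :: "nat \<Rightarrow> nat \<times> nat \<Rightarrow> bool"
  have \<rho>: "of_bool (\<exists>j\<in>S. realization_of \<omega> i j t) = \<rho> (\<lambda>s\<in>{t}. slot s \<omega>)" for \<omega>
    using i S by (auto simp: \<rho>_def realization_of_def links_def subset_iff)
  have "indep_var borel (\<psi> \<circ> (\<lambda>\<omega>. \<lambda>s\<in>{1..t-1}. slot s \<omega>)) borel (\<rho> \<circ> (\<lambda>\<omega>. \<lambda>s\<in>{t}. slot s \<omega>))"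
    using t by (intro indep_var_compose[OF indep_var_restrict[OF indep_over_time]])
      (auto simp: block_space)
  then have ind: "indep_var borel (\<lambda>\<omega>. \<phi> (realization_of \<omega>)) borel (\<lambda>\<omega>. of_bool (\<exists>j\<in>S. realization_of \<omega> i j t))"
    by (simp add: comp_def \<psi> \<rho>)
  have dep: "depends_upto t (\<lambda>z. of_bool (\<exists>j\<in>S. z i j t))"
  proof -
    have "(\<exists>j\<in>S. z i j t) = (\<exists>j\<in>S. z' i j t)" if "agree t z z'" for z z'
      using agreeD[OF that t order_refl] S by (intro bex_cong refl) auto
    then show ?thesis unfolding depends_upto_def by (intro allI impI arg_cong[where f = of_bool])
  qed
  note Zm = all_erased_event[OF t i S]
  have "mean (\<lambda>z. of_bool (\<exists>j\<in>S. z i j t)) = expectation (indicator (space M - {\<omega> \<in> space M. \<forall>j\<in>S. \<not> Z i j t \<omega>}))"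
    unfolding mean_def by (rule Bochner_Integration.integral_cong) (auto simp: realization_of_def indicator_def)
  also have "\<dots> = 1 - \<epsilon> i S"
    using prob_compl[OF Zm] Zm erasure_prob[OF t i S] by simp
  finally show ?thesis
    using indep_var_lebesgue_integral[OF ind integrable_depends_upto[OF \<phi>] integrable_depends_upto[OF dep]]
    by (simp add: mean_def mult.commute)
qed

end

section \<open>Uniform messages and the error probability\<close>

lemma pmf_replicate_of_set:
  "pmf (replicate_pmf L (pmf_of_set (UNIV :: 'f::finite set))) w =
     (if length w = L then 1 / CARD('f) ^ L else 0)"
proof (induction L arbitrary: w)
  case 0
  then show ?case by (auto simp: pmf_return)
next
  case (Suc L)
  have eq: "replicate_pmf (Suc L) (pmf_of_set (UNIV :: 'f set)) =
    map_pmf (\<lambda>(x, xs). x # xs) (pair_pmf (pmf_of_set UNIV) (replicate_pmf L (pmf_of_set UNIV)))"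
    by (simp add: pair_pmf_def map_bind_pmf)
  show ?case
  proof (cases w)
    case Nil
    then show ?thesis by (auto simp: pmf_eq_0_set_pmf set_replicate_pmf simp del: replicate_pmf.simps)
  next
    case (Cons x xs)
    have "pmf (replicate_pmf (Suc L) (pmf_of_set (UNIV :: 'f set))) w =
      pmf (pair_pmf (pmf_of_set UNIV) (replicate_pmf L (pmf_of_set UNIV))) (x, xs)"
      unfolding eq using pmf_map_inj'[of "\<lambda>(x, xs). x # xs" _ "(x, xs)"] Cons by (simp add: inj_def)
    then show ?thesis using Cons by (simp add: pmf_pair Suc)
  qed
qed

locale coded_network = erasure_network M Z \<epsilon> + relay_code c n L1 L2
  for M :: "'w measure" and Z \<epsilon> and c :: "'f::{finite, field} code" and n L1 L2
begin

lemma messages_eq: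
  assumes "L1 = msg_len n R1" "L2 = msg_len n R2"
  shows "messages n R1 R2 = pmf_of_set W"
proof (rule pmf_eqI)
  fix w :: "'f list \<times> 'f list"
  show "pmf (messages n R1 R2) w = pmf (pmf_of_set W) w"
    using fin nonempty mem_Sigma_iff[of "fst w" "snd w"]
    by (cases w)
      (simp add: messages_def assms[symmetric] pmf_pair pmf_replicate_of_set card_W power_add indicator_def,
        simp add: W_def)
qed

lemma depends_upto_err: "depends_upto n err"
  unfolding depends_upto_def using err_agree by blast

text \<open>Fubini: for fixed erasures the inner integral over the uniform messages is the fraction
  counted by \<open>err\<close>.\<close>

lemma mean_err:
  assumes "L1 = msg_len n R1" "L2 = msg_len n R2"
  shows "mean err = error_prob M Z n R1 R2 c"
proof -
  let ?N = "measure_pmf (messages n R1 R2 :: ('f list \<times> 'f list) pmf)"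
  let ?bad = "\<lambda>w. {\<omega> \<in> space M. decoding_error n c (fst w) (snd w) (realization_of \<omega>)}"
  let ?E = "{(\<omega>, (w1, w2)) | \<omega> w1 w2. \<omega> \<in> space M \<and> decoding_error n c w1 w2 (\<lambda>i j t. Z i j t \<omega>)}"
  interpret P: pair_prob_space M ?N ..
  have bad: "?bad w \<in> events" for w
  proof -
    have "depends_upto n (\<lambda>z. of_bool (decoding_error n c (fst w) (snd w) z))"
      unfolding depends_upto_def by (auto simp: decoding_error_agree[of n _ _ c])
    from borel_measurable_integrable[OF integrable_depends_upto[OF this]]
    have "{\<omega> \<in> space M. of_bool (decoding_error n c (fst w) (snd w) (realization_of \<omega>)) = (1 :: real)} \<in> events"
      by measurable
    then show ?thesis by simp
  qed
  \<comment> \<open>There are only countably many message pairs, so the error event is a countable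
    union of measurable rectangles.\<close>
  have "?E = (\<Union>w\<in>UNIV. ?bad w \<times> {w})"
    by (auto simp: realization_of_def)
  also have "\<dots> \<in> sets (M \<Otimes>\<^sub>M ?N)"
    using bad by (intro sets.countable_UN' pair_measureI) auto
  finally have E: "?E \<in> sets (M \<Otimes>\<^sub>M ?N)" .
  have "emeasure (M \<Otimes>\<^sub>M ?N) ?E = (\<integral>\<^sup>+\<omega>. emeasure ?N (Pair \<omega> -` ?E) \<partial>M)"
    using E by (rule measure_pmf.emeasure_pair_measure_alt)
  also have "\<dots> = (\<integral>\<^sup>+\<omega>. ennreal (err (realization_of \<omega>)) \<partial>M)"
  proof (rule nn_integral_cong)
    fix \<omega> assume "\<omega> \<in> space M"
    then have "Pair \<omega> -` ?E = {w. decoding_error n c (fst w) (snd w) (realization_of \<omega>)}"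
      by (auto simp: realization_of_def)
    then show "emeasure ?N (Pair \<omega> -` ?E) = ennreal (err (realization_of \<omega>))"
      using fin nonempty
      by (simp add: messages_eq[OF assms] measure_pmf.emeasure_eq_measure measure_pmf_of_set err_def Int_def)
  qed
  also have "\<dots> = ennreal (mean err)"
    unfolding mean_def using integrable_depends_upto[OF depends_upto_err] err_nonneg
    by (intro nn_integral_eq_integral) auto
  finally have "measure (M \<Otimes>\<^sub>M ?N) ?E = mean err"
    using err_nonneg by (simp add: measure_def mean_def)
  then show ?thesis by (simp add: error_prob_def)
qed

section \<open>Expected totals over a block\<close>

definition total_mean :: "(realization \<Rightarrow> nat \<Rightarrow> real) \<Rightarrow> real" where
  "total_mean F = (\<Sum>t=1..n. mean (\<lambda>z. F z t))"

text \<open>Predictability: the value for slot \<open>t\<close> is fixed before the erasures of that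
  slot are drawn.\<close>

definition adapted :: "(realization \<Rightarrow> nat \<Rightarrow> real) \<Rightarrow> bool" where
  "adapted F \<longleftrightarrow> (\<forall>t. depends_upto (t - 1) (\<lambda>z. F z t))"

lemma adaptedI: "(\<And>t z z'. agree (t - 1) z z' \<Longrightarrow> F z t = F z' t) \<Longrightarrow> adapted F"
  unfolding adapted_def depends_upto_def by blast

lemma adaptedD: "adapted F \<Longrightarrow> agree (t - 1) z z' \<Longrightarrow> F z t = F z' t"
  unfolding adapted_def depends_upto_def by blast

lemma total_mean_add: "adapted F \<Longrightarrow> adapted G \<Longrightarrow> total_mean (\<lambda>z t. F z t + G z t) = total_mean F + total_mean G"
  unfolding total_mean_def adapted_def sum.distrib[symmetric]
  by (intro sum.cong refl mean_add) blast+

lemma adapted_add: "adapted F \<Longrightarrow> adapted G \<Longrightarrow> adapted (\<lambda>z t. F z t + G z t)"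
  by (rule adaptedI) (metis adaptedD)

lemma total_mean_mono:
  "adapted F \<Longrightarrow> adapted G \<Longrightarrow> (\<And>z t. t \<in> {1..n} \<Longrightarrow> F z t \<le> G z t) \<Longrightarrow>
    total_mean F \<le> total_mean G"
  unfolding total_mean_def adapted_def by (intro sum_mono mean_mono) blast+

lemma total_mean_cong: "(\<And>z t. t \<in> {1..n} \<Longrightarrow> F z t = G z t) \<Longrightarrow> total_mean F = total_mean G"
  unfolding total_mean_def by (intro sum.cong refl arg_cong[where f = mean] ext) auto

lemma total_mean_const: "total_mean (\<lambda>_ _. k) = real n * k"
  by (simp add: total_mean_def mean_const)

lemma adapted_const: "adapted (\<lambda>_ _. k)"
  by (rule adaptedI) simp

lemma total_mean_nonneg: "adapted F \<Longrightarrow> (\<And>z t. 0 \<le> F z t) \<Longrightarrow> 0 \<le> total_mean F"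
  using total_mean_mono[OF adapted_const[of 0], of F] by (simp add: total_mean_const)

lemma total_mean_le: "adapted F \<Longrightarrow> (\<And>z t. F z t \<le> 1) \<Longrightarrow> total_mean F \<le> n"
  using total_mean_mono[OF _ adapted_const[of 1], of F] by (simp add: total_mean_const)

definition sends :: "nat \<Rightarrow> nat set \<Rightarrow> ('f list \<times> 'f list \<Rightarrow> 'v) \<Rightarrow> realization \<Rightarrow> nat \<Rightarrow> real" where
  "sends i S V z t = of_bool (active c z t = i) * h z S V t"

lemma adapted_active: "adapted (\<lambda>z t. of_bool (active c z t = i))"
  by (rule adaptedI) (simp add: active_agree[of _ _ _ c])

lemma adapted_sends: "adapted (sends i S V)"
  by (rule adaptedI) (simp add: sends_def active_agree[of _ _ _ c] h_agree)

lemma adapted_new: "adapted (\<lambda>z. new z S)"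
  by (rule adaptedI)
    (simp add: new_def active_agree[of _ _ _ c] packet_agree[of _ _ _ c] got_agree[of _ _ _ c])

lemma adapted_gain: "adapted gain"
  by (rule adaptedI)
    (simp add: gain_def active_agree[of _ _ _ c] packet_agree[of _ _ _ c] got_agree[of _ _ _ c] h_agree)

lemma adapted_side: "adapted side"
  by (rule adaptedI)
    (simp add: side_def active_agree[of _ _ _ c] packet_agree[of _ _ _ c] got_agree[of _ _ _ c] h_agree)

lemma adapted_useless: "adapted useless"
  by (rule adaptedI)
    (simp add: useless_def active_agree[of _ _ _ c] packet_agree[of _ _ _ c] got_agree[of _ _ _ c])

lemma depends_upto_H: "depends_upto n (\<lambda>z. H z S V n)"
  unfolding depends_upto_def using H_agree by blast

text \<open>The summed chain rule, split by transmitter. In each slot reception is independent of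
  the predictable entropy \<open>h\<close>, which produces the factors
  \<open>1 - \<epsilon> i\<close>.\<close>

lemma mean_H:
  "mean (\<lambda>z. H z S V n) = ent V + (1 - \<epsilon> 1 (S \<inter> nbrs 1)) * total_mean (sends 1 S V)
     + (1 - \<epsilon> 2 (S \<inter> nbrs 2)) * total_mean (sends 2 S V)"
proof -
  let ?r = "\<lambda>i t z. sends i S V z t * of_bool (\<exists>j\<in>S \<inter> nbrs i. z i j t)"
  have dep: "depends_upto n (?r i t)" if "t \<in> {1..n}" "i \<in> {1, 2}" for i t
  proof -
    have "?r i t z = ?r i t z'" if a: "agree n z z'" for z z'
      using adaptedD[OF adapted_sends, of t z z' i S V] agree_mono[OF a, of "t - 1"] \<open>t \<in> {1..n}\<close>
        agreeD[OF a, of t _ i] by (intro arg_cong2[where f = "(*)"] arg_cong[where f = of_bool] bex_cong refl) auto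
    then show ?thesis unfolding depends_upto_def by blast
  qed
  have split: "of_bool (heard c z S t) * h z S V t = ?r 1 t z + ?r 2 t z" if "t \<in> {1..n}" for z t
    using active_cases[OF that, of z] by (auto simp: sends_def heard_def)
  have "mean (\<lambda>z. H z S V n) = mean (\<lambda>z. ent V + (\<Sum>t=1..n. ?r 1 t z + ?r 2 t z))"
    unfolding H_eq_sum using split by (intro arg_cong[where f = mean] ext) simp
  also have "\<dots> = ent V + (\<Sum>t=1..n. mean (?r 1 t) + mean (?r 2 t))"
  proof -
    have dep2: "depends_upto n (\<lambda>z. ?r 1 t z + ?r 2 t z)" if "t \<in> {1..n}" for t
      using dep[OF that] by (intro depends_upto_add) auto
    have "mean (\<lambda>z. ent V + (\<Sum>t=1..n. ?r 1 t z + ?r 2 t z)) =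
        mean (\<lambda>z. ent V) + mean (\<lambda>z. \<Sum>t=1..n. ?r 1 t z + ?r 2 t z)"
      by (intro mean_add[of n] depends_upto_sum depends_upto_const dep2)
    also have "mean (\<lambda>z. \<Sum>t=1..n. ?r 1 t z + ?r 2 t z) = (\<Sum>t=1..n. mean (\<lambda>z. ?r 1 t z + ?r 2 t z))"
      using dep2 by (rule mean_sum)
    also have "\<dots> = (\<Sum>t=1..n. mean (?r 1 t) + mean (?r 2 t))"
      using dep by (intro sum.cong refl mean_add) auto
    finally show ?thesis
      by (simp only: mean_const)
  qed
  also have "(\<Sum>t=1..n. mean (?r 1 t) + mean (?r 2 t)) = (\<Sum>t=1..n. (1 - \<epsilon> 1 (S \<inter> nbrs 1)) * mean (\<lambda>z. sends 1 S V z t)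
      + (1 - \<epsilon> 2 (S \<inter> nbrs 2)) * mean (\<lambda>z. sends 2 S V z t))"
    using adapted_sends unfolding adapted_def
    by (intro sum.cong refl arg_cong2[where f = "(+)"] mean_mult_received) auto
  finally show ?thesis
    by (simp add: total_mean_def sum.distrib sum_distrib_left)
qed

lemma mean_H_le: "mean (\<lambda>z. H z S V n) \<le> L1 + L2"
  using mean_mono[OF depends_upto_H depends_upto_const H_le, of S V]
  by (simp add: mean_const)

lemma mean_le_fano:
  assumes "depends_upto n \<phi>" "depends_upto n \<psi>" "\<And>z. \<phi> z \<le> \<psi> z + (1 + err z * L)"
  shows "mean \<phi> \<le> mean \<psi> + (1 + mean err * L)"
proof -
  have e: "depends_upto n (\<lambda>z. err z * L)"
    using depends_upto_err by (rule depends_upto_mult_left)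
  have "mean \<phi> \<le> mean (\<lambda>z. \<psi> z + (1 + err z * L))"
    using assms e by (intro mean_mono[of n] depends_upto_add depends_upto_const) auto
  also have "\<dots> = mean \<psi> + mean (\<lambda>z. 1 + err z * L)"
    using assms e by (intro mean_add[of n] depends_upto_add depends_upto_const) auto
  also have "mean (\<lambda>z. 1 + err z * L) = mean (\<lambda>z. 1) + mean (\<lambda>z. err z * L)"
    using e by (intro mean_add[of n] depends_upto_const) auto
  finally show ?thesis by (simp add: mean_const mean_mult)
qed

section \<open>Linear inequalities at a fixed block length\<close>

lemma eps_le_1: "i \<in> {1, 2} \<Longrightarrow> S \<subseteq> nbrs i \<Longrightarrow> \<epsilon> i S \<le> 1"
  using erasure_prob[of 1 i S] by simp

lemma sends_bounds: "0 \<le> sends i S V z t" "sends i S V z t \<le> of_bool (active c z t = i)"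
  using h_nonneg[of z S V t] h_le_1[of z S V t] by (auto simp: sends_def)

lemma total_sends_mono:
  assumes "S \<subseteq> S'" "determines V' V"
  shows "total_mean (sends i S' V') \<le> total_mean (sends i S V)"
  using h_antimono[OF assms] by (intro total_mean_mono adapted_sends) (simp add: sends_def)

lemma total_sends_le: "total_mean (sends i S V) \<le> total_mean (\<lambda>z t. of_bool (active c z t = i))"
  using sends_bounds by (intro total_mean_mono adapted_sends adapted_active)

lemma total_sends_1_fst: "total_mean (sends 1 S fst) = 0"
  using total_mean_cong[of "sends 1 S fst" "\<lambda>_ _. 0"] h_fst_eq_0
  by (auto simp: sends_def total_mean_const)

lemma total_sends_2_snd: "2 \<in> S \<Longrightarrow> total_mean (sends 2 S snd) = 0"
  using total_mean_cong[of "sends 2 S snd" "\<lambda>_ _. 0"] h_snd_eq_0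
  by (auto simp: sends_def total_mean_const)

lemma total_sends_1_snd: "2 \<in> S \<Longrightarrow> total_mean (sends 1 S snd) = total_mean (\<lambda>z. new z S)"
  using h_snd_eq_new by (intro total_mean_cong) (simp add: sends_def)

lemma new_bounds: "0 \<le> new z S t" "new z S t \<le> 1"
  by (auto simp: new_def)

text \<open>\<open>N\<close> and \<open>N'\<close> count packets new to \<open>{2, 3}\<close> and to
  \<open>{2, 3, 4}\<close>, and \<open>T\<close> the slots of node 2. \<open>P\<close> and
  \<open>Q\<close> measure what node 2 sends to \<open>{3, 4}\<close> beyond \<open>w1\<close> and
  beyond \<open>w2\<close>. \<open>\<kappa>1\<close> and \<open>\<kappa>2\<close> are the Fano
  terms.\<close>

lemma code_bounds:
  fixes N N' G S U T P Q \<kappa>1 \<kappa>2 :: real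
  defines "N \<equiv> total_mean (\<lambda>z. new z {2, 3})" and "N' \<equiv> total_mean (\<lambda>z. new z {2, 3, 4})"
    and "G \<equiv> total_mean gain" and "S \<equiv> total_mean side" and "U \<equiv> total_mean useless"
    and "T \<equiv> total_mean (\<lambda>z t. of_bool (active c z t = 2))"
    and "P \<equiv> total_mean (sends 2 {3, 4} fst)" and "Q \<equiv> total_mean (sends 2 {3, 4} snd)"
    and "\<kappa>1 \<equiv> 1 + mean err * L1" and "\<kappa>2 \<equiv> 1 + mean err * L2"
  shows "N + G + S + U + T = n"
    and "0 \<le> N" "0 \<le> G" "0 \<le> S" "0 \<le> U" "0 \<le> T" "0 \<le> N'" "N' \<le> n" "0 \<le> P" "P \<le> n" "0 \<le> Q" "Q \<le> n"
    and "L1 \<le> (1 - \<epsilon> 1 {2, 3}) * N + \<kappa>1"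
    and "(1 - \<epsilon> 1 {2, 3}) * N \<le> L1"
    and "(1 - \<epsilon> 1 {2, 3, 4}) * N' \<le> L1"
    and "L2 \<le> (1 - \<epsilon> 2 {4}) * T + \<kappa>2"
    and "L1 + (1 - \<epsilon> 2 {3}) * P \<le> (1 - \<epsilon> 2 {3}) * T + (1 - \<epsilon> 1 {3}) * (N + G + S) + \<kappa>1"
    and "L2 \<le> (1 - \<epsilon> 2 {3, 4}) * P + \<kappa>2"
    and "L2 + (1 - \<epsilon> 2 {4}) * Q \<le> (1 - \<epsilon> 2 {4}) * T + (1 - \<epsilon> 1 {4}) * (S + U) + \<kappa>2"
    and "L1 \<le> (1 - \<epsilon> 2 {3, 4}) * Q + (1 - \<epsilon> 1 {3, 4}) * (N' + G) + \<kappa>1"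
proof -
  note ad = adapted_add adapted_sends adapted_new adapted_gain adapted_side adapted_useless adapted_active
  have nb: "{2, 3} \<inter> nbrs 1 = {2, 3}" "{2, 3, 4} \<inter> nbrs 1 = {2, 3, 4}" "{3} \<inter> nbrs 1 = {3}" "{4} \<inter> nbrs 1 = {4}"
    "{3, 4} \<inter> nbrs 1 = {3, 4}" "{3} \<inter> nbrs 2 = {3}" "{4} \<inter> nbrs 2 = {4}" "{3, 4} \<inter> nbrs 2 = {3, 4}"
    by (auto simp: nbrs_def)
  have eps: "\<epsilon> 1 {3} \<le> 1" "\<epsilon> 1 {4} \<le> 1" "\<epsilon> 1 {3, 4} \<le> 1" "\<epsilon> 2 {3} \<le> 1" "\<epsilon> 2 {4} \<le> 1" "\<epsilon> 2 {3, 4} \<le> 1"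
    by (auto intro!: eps_le_1 simp: nbrs_def)
  note mean_H_const = mean_H[of _ "\<lambda>_. ()", unfolded ent_const]
  note mean_H_fst = mean_H[of _ fst, unfolded ent_fst total_sends_1_fst]
  note mean_H_snd = mean_H[of _ snd, unfolded ent_snd]

  have "total_mean (\<lambda>_ _. 1) = total_mean (\<lambda>z t. of_bool (active c z t = 2) + new z {2, 3} t + gain z t + side z t + useless z t)"
    using time_split by (intro total_mean_cong) simp
  also have "\<dots> = T + N + G + S + U"
    unfolding T_def N_def G_def S_def U_def by (simp add: total_mean_add ad)
  finally show "N + G + S + U + T = n"
    by (simp add: total_mean_const)
  show "0 \<le> N" "0 \<le> G" "0 \<le> S" "0 \<le> U" "0 \<le> T" "0 \<le> N'" "0 \<le> P" "0 \<le> Q"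
    unfolding N_def G_def S_def U_def T_def N'_def P_def Q_def
    by (intro total_mean_nonneg ad; simp add: new_bounds gain_side_useless_nonneg sends_bounds)+
  have sends_le_1: "sends i A V z t \<le> 1" for i A V z t
    using sends_bounds(2)[of i A V z t] by (simp add: of_bool_def split: if_splits)
  show "N' \<le> n" "P \<le> n" "Q \<le> n"
    unfolding N'_def P_def Q_def by (intro total_mean_le ad; simp add: new_bounds sends_le_1)+

  \<comment> \<open>Given \<open>w2\<close>, a set containing node 2 learns nothing from the symbols
    of node 2, and a full unit from each new packet it hears.\<close>
  have relay: "total_mean (sends 1 {2, 3} snd) = N" "total_mean (sends 2 {2, 3} snd) = 0"
    "total_mean (sends 1 {2, 3, 4} snd) = N'" "total_mean (sends 2 {2, 3, 4} snd) = 0"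
    unfolding N_def N'_def by (intro total_sends_1_snd total_sends_2_snd insertI1)+
  have 1: "real L1 + L2 \<le> mean (\<lambda>z. H z {2, 3} snd n) + \<kappa>1"
    using mean_le_fano[OF depends_upto_const depends_upto_H, of "real (L1 + L2)" "{2, 3}" snd L1] le_H_snd
    by (simp add: mean_const \<kappa>1_def)
  show "L1 \<le> (1 - \<epsilon> 1 {2, 3}) * N + \<kappa>1"
    using 1 unfolding mean_H_snd nb relay by simp
  show "(1 - \<epsilon> 1 {2, 3}) * N \<le> L1"
    using mean_H_le[of "{2, 3}" snd] unfolding mean_H_snd nb relay by simp
  show "(1 - \<epsilon> 1 {2, 3, 4}) * N' \<le> L1"
    using mean_H_le[of "{2, 3, 4}" snd] unfolding mean_H_snd nb relay by simp

  have "real L1 + L2 \<le> mean (\<lambda>z. H z {4} fst n) + \<kappa>2"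
    using mean_le_fano[OF depends_upto_const depends_upto_H, of "real (L1 + L2)" "{4}" fst L2] le_H_fst
    by (simp add: mean_const \<kappa>2_def)
  moreover have "(1 - \<epsilon> 2 {4}) * total_mean (sends 2 {4} fst) \<le> (1 - \<epsilon> 2 {4}) * T"
    unfolding T_def using eps by (intro mult_left_mono total_sends_le) auto
  ultimately show "L2 \<le> (1 - \<epsilon> 2 {4}) * T + \<kappa>2"
    unfolding mean_H_fst nb by simp

  \<comment> \<open>The knowledge of node 3 is compared with and without \<open>w1\<close> revealed.
    \<open>P\<close> bounds the node 2 term from below because \<open>{3, 4}\<close> knows more than
    \<open>{3}\<close>.\<close>
  have "mean (\<lambda>z. H z {3} fst n) \<le> mean (\<lambda>z. H z {3} (\<lambda>_. ()) n) + \<kappa>1"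
    unfolding \<kappa>1_def using H_fst_le by (intro mean_le_fano depends_upto_H) auto
  moreover have "(1 - \<epsilon> 2 {3}) * P \<le> (1 - \<epsilon> 2 {3}) * total_mean (sends 2 {3} fst)"
    unfolding P_def using eps by (intro mult_left_mono total_sends_mono) (auto simp: determines_refl)
  moreover have "(1 - \<epsilon> 2 {3}) * total_mean (sends 2 {3} (\<lambda>_. ())) \<le> (1 - \<epsilon> 2 {3}) * T"
    unfolding T_def using eps by (intro mult_left_mono total_sends_le) auto
  moreover have "(1 - \<epsilon> 1 {3}) * total_mean (sends 1 {3} (\<lambda>_. ())) \<le> (1 - \<epsilon> 1 {3}) * (N + G + S)"
  proof (rule mult_left_mono)
    have "total_mean (sends 1 {3} (\<lambda>_. ())) \<le> total_mean (\<lambda>z t. new z {2, 3} t + gain z t + side z t)"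
      by (intro total_mean_mono ad) (unfold sends_def, rule h_3_le)
    then show "total_mean (sends 1 {3} (\<lambda>_. ())) \<le> N + G + S"
      by (simp add: total_mean_add ad N_def G_def S_def)
  qed (use eps in simp)
  ultimately show "L1 + (1 - \<epsilon> 2 {3}) * P \<le> (1 - \<epsilon> 2 {3}) * T + (1 - \<epsilon> 1 {3}) * (N + G + S) + \<kappa>1"
    unfolding mean_H_fst mean_H_const nb by simp

  \<comment> \<open>Given \<open>w1\<close>, only symbols of node 2 carry information, and
    \<open>{3, 4}\<close> must obtain \<open>w2\<close> from them.\<close>
  have "real L1 + L2 \<le> mean (\<lambda>z. H z {3, 4} fst n) + \<kappa>2"
    using mean_le_fano[OF depends_upto_const depends_upto_H, of "real (L1 + L2)" "{3, 4}" fst L2] le_H_fst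
    by (simp add: mean_const \<kappa>2_def)
  then show "L2 \<le> (1 - \<epsilon> 2 {3, 4}) * P + \<kappa>2"
    unfolding mean_H_fst nb P_def by simp

  \<comment> \<open>The same comparison for node 4 and \<open>w2\<close>. The node 1 terms given
    \<open>w2\<close> occur on both sides and cancel, which leaves \<open>S + U\<close>.\<close>
  have "mean (\<lambda>z. H z {4} snd n) \<le> mean (\<lambda>z. H z {4} (\<lambda>_. ()) n) + \<kappa>2"
    unfolding \<kappa>2_def using H_snd_le by (intro mean_le_fano depends_upto_H) auto
  moreover have "(1 - \<epsilon> 2 {4}) * Q \<le> (1 - \<epsilon> 2 {4}) * total_mean (sends 2 {4} snd)"
    unfolding Q_def using eps by (intro mult_left_mono total_sends_mono) (auto simp: determines_refl)
  moreover have "(1 - \<epsilon> 2 {4}) * total_mean (sends 2 {4} (\<lambda>_. ())) \<le> (1 - \<epsilon> 2 {4}) * T"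
    unfolding T_def using eps by (intro mult_left_mono total_sends_le) auto
  moreover have "(1 - \<epsilon> 1 {4}) * total_mean (sends 1 {4} (\<lambda>_. ()))
      \<le> (1 - \<epsilon> 1 {4}) * (total_mean (sends 1 {4} snd) + S + U)"
  proof (rule mult_left_mono)
    have "total_mean (sends 1 {4} (\<lambda>_. ())) \<le> total_mean (\<lambda>z t. sends 1 {4} snd z t + side z t + useless z t)"
      by (intro total_mean_mono ad) (unfold sends_def, rule h_4_le)
    then show "total_mean (sends 1 {4} (\<lambda>_. ())) \<le> total_mean (sends 1 {4} snd) + S + U"
      by (simp add: total_mean_add ad S_def U_def)
  qed (use eps in simp)
  ultimately show "L2 + (1 - \<epsilon> 2 {4}) * Q \<le> (1 - \<epsilon> 2 {4}) * T + (1 - \<epsilon> 1 {4}) * (S + U) + \<kappa>2"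
    unfolding mean_H_snd mean_H_const nb by (simp add: distrib_left)

  \<comment> \<open>Given \<open>w2\<close>, the set \<open>{3, 4}\<close> must obtain
    \<open>w1\<close> from both transmitters; \<open>Q\<close> measures the part of node 2.\<close>
  have "real L1 + L2 \<le> mean (\<lambda>z. H z {3, 4} snd n) + \<kappa>1"
    using mean_le_fano[OF depends_upto_const depends_upto_H, of "real (L1 + L2)" "{3, 4}" snd L1] le_H_snd
    by (simp add: mean_const \<kappa>1_def)
  moreover have "(1 - \<epsilon> 1 {3, 4}) * total_mean (sends 1 {3, 4} snd) \<le> (1 - \<epsilon> 1 {3, 4}) * (N' + G)"
  proof (rule mult_left_mono)
    have "total_mean (sends 1 {3, 4} snd) \<le> total_mean (\<lambda>z t. new z {2, 3, 4} t + gain z t)"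
      by (intro total_mean_mono ad) (unfold sends_def, rule h_34_le)
    then show "total_mean (sends 1 {3, 4} snd) \<le> N' + G"
      by (simp add: total_mean_add ad N'_def G_def)
  qed (use eps in simp)
  ultimately show "L1 \<le> (1 - \<epsilon> 2 {3, 4}) * Q + (1 - \<epsilon> 1 {3, 4}) * (N' + G) + \<kappa>1"
    unfolding mean_H_snd nb Q_def by simp
qed

end

section \<open>Normalization and limit\<close>

text \<open>
  The variables are the limits of \<open>N, N', G, S, U, T, P, Q\<close> of \<open>code_bounds\<close>, divided by the block length.
\<close>

definition constraints :: "(nat \<Rightarrow> nat set \<Rightarrow> real) \<Rightarrow>
    ((real \<times> real \<times> real \<times> real) \<times> (real \<times> real \<times> real \<times> real \<times> real \<times> real \<times> real \<times> real)) set" where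
  "constraints \<epsilon> = {((a1, a2, k1, k2), (N, N', G, S, U, T, P, Q)).
     N + G + S + U + T = 1 \<and>
     a1 \<le> (1 - \<epsilon> 1 {2, 3}) * N + k1 \<and>
     (1 - \<epsilon> 1 {2, 3}) * N \<le> a1 \<and>
     (1 - \<epsilon> 1 {2, 3, 4}) * N' \<le> a1 \<and>
     a2 \<le> (1 - \<epsilon> 2 {4}) * T + k2 \<and>
     a1 + (1 - \<epsilon> 2 {3}) * P \<le> (1 - \<epsilon> 2 {3}) * T + (1 - \<epsilon> 1 {3}) * (N + G + S) + k1 \<and>
     a2 \<le> (1 - \<epsilon> 2 {3, 4}) * P + k2 \<and>
     a2 + (1 - \<epsilon> 2 {4}) * Q \<le> (1 - \<epsilon> 2 {4}) * T + (1 - \<epsilon> 1 {4}) * (S + U) + k2 \<and>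
     a1 \<le> (1 - \<epsilon> 2 {3, 4}) * Q + (1 - \<epsilon> 1 {3, 4}) * (N' + G) + k1}"

lemma closed_constraints: "closed (constraints \<epsilon>)"
  unfolding constraints_def case_prod_unfold
  by (intro closed_Collect_conj closed_Collect_le closed_Collect_eq continuous_intros)

text \<open>The variables stay in a compact cube, so some subsequence converges; the parameters
  converge along it too, and the constraint set is closed.\<close>

lemma constraints_limit:
  fixes x :: "nat \<Rightarrow> real \<times> real \<times> real \<times> real \<times> real \<times> real \<times> real \<times> real"
  defines "B \<equiv> {0..1} \<times> {0..1} \<times> {0..1} \<times> {0..1} \<times> {0..1} \<times> {0..1} \<times> {0..1} \<times> {0..1}"
  assumes x: "\<And>n. x n \<in> B" "\<And>n. (r n, x n) \<in> constraints \<epsilon>" and r: "r \<longlonglongrightarrow> \<rho>"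
  shows "\<exists>l\<in>B. (\<rho>, l) \<in> constraints \<epsilon>"
proof -
  have "compact B"
    unfolding B_def by (intro compact_Times compact_Icc)
  then obtain l \<sigma> where l: "l \<in> B" and \<sigma>: "strict_mono \<sigma>" "(x \<circ> \<sigma>) \<longlonglongrightarrow> l"
    using x(1) unfolding compact_def by blast
  have "(\<lambda>k. (r (\<sigma> k), x (\<sigma> k))) \<longlonglongrightarrow> (\<rho>, l)"
    using LIMSEQ_subseq_LIMSEQ[OF r \<sigma>(1)] \<sigma>(2) by (intro tendsto_Pair) (auto simp: comp_def)
  then have "(\<rho>, l) \<in> constraints \<epsilon>"
    using closed_sequentially[OF closed_constraints, of "\<lambda>k. (r (\<sigma> k), x (\<sigma> k))"] x(2) by blast
  with l show ?thesis by blast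
qed

text \<open>With zero slack \<open>N\<close> equals \<open>R1 / a\<close>, and the time balance
  gives \<open>T\<close>. Eliminating \<open>P\<close>, \<open>Q\<close> and \<open>N'\<close> then
  leaves the inequalities of the region.\<close>

lemma outer_region_if_constraints:
  assumes con: "((R1, R2, 0, 0), (N, N', G, S, U, T, P, Q)) \<in> constraints \<epsilon>"
    and nn: "0 \<le> G" "0 \<le> S" "0 \<le> U" "0 \<le> R1" "0 \<le> R2"
    and pos: "\<epsilon> 1 {2, 3} < 1" "\<epsilon> 1 {2, 3, 4} < 1" "\<epsilon> 2 {3} < 1" "\<epsilon> 2 {4} < 1" "\<epsilon> 2 {3, 4} < 1"
    and le: "\<epsilon> 1 {3, 4} \<le> 1"
  shows "(R1, R2) \<in> outer_region \<epsilon>"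
proof -
  define a b c d e f g i where "a = 1 - \<epsilon> 1 {2, 3}" and "b = 1 - \<epsilon> 2 {4}" and "c = 1 - \<epsilon> 1 {3}"
    and "d = 1 - \<epsilon> 2 {3}" and "e = 1 - \<epsilon> 2 {3, 4}" and "f = 1 - \<epsilon> 1 {3, 4}" and "g = 1 - \<epsilon> 1 {2, 3, 4}"
    and "i = 1 - \<epsilon> 1 {4}"
  note ab = this
  have p: "0 < a" "0 < b" "0 < d" "0 < e" "0 < g" "0 \<le> f"
    using pos le by (auto simp: ab)
  have eq: "N + G + S + U + T = 1" "a * N = R1" and le': "g * N' \<le> R1" "R2 \<le> b * T"
    "R1 + d * P \<le> d * T + c * (N + G + S)" "R2 \<le> e * P" "R2 + b * Q \<le> b * T + i * (S + U)"
    "R1 \<le> e * Q + f * (N' + G)"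
    using con by (auto simp: constraints_def ab)
  have N: "N = R1 / a"
    using eq(2) p by (auto simp: field_simps)
  have T: "T = 1 - G - S - U - R1 / a"
    using eq(1) N by simp
  have P: "R2 / e \<le> P"
    using le'(4) p by (simp add: field_simps)
  have 1: "R1 / a + R2 / b \<le> 1 - G - S - U"
  proof -
    have "R2 / b \<le> T" using le'(2) p by (simp add: field_simps)
    then show ?thesis using T by simp
  qed
  have 2: "((a - c) / (d * a) + 1 / a) * R1 + R2 / e \<le> 1 - G - S - U + c / d * (G + S)"
  proof -
    have "(R1 + d * P) / d \<le> (d * T + c * (N + G + S)) / d"
      using le'(3) p by (intro divide_right_mono) auto
    then have "R1 / d + P \<le> T + c / d * (N + G + S)"
      using p by (simp add: add_divide_distrib)
    moreover have "((a - c) / (d * a) + 1 / a) * R1 = R1 / d - c / d * N + R1 / a"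
      using p unfolding N by (simp add: field_simps)
    moreover have "c / d * (N + G + S) = c / d * N + c / d * (G + S)"
      by (simp only: distrib_left add.assoc)
    ultimately show ?thesis using P T by linarith
  qed
  have 3: "((g - f) / (g * e) + 1 / a) * R1 + R2 / b \<le> 1 - G - S - U + f / e * G + i / b * (S + U)"
  proof -
    have "R1 / e \<le> (e * Q + f * (N' + G)) / e"
      using le'(6) p by (intro divide_right_mono) auto
    then have q: "R1 / e \<le> Q + f / e * N' + f / e * G"
      using p by (simp add: add_divide_distrib distrib_left)
    have "N' \<le> R1 / g"
      using le'(1) p by (simp add: field_simps)
    \<comment> \<open>Since \<open>f\<close> is nonnegative, the upper bound on \<open>N'\<close>
      may be inserted here.\<close>
    then have "f / e * N' \<le> f / e * (R1 / g)"
      using p by (intro mult_left_mono) auto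
    moreover have "((g - f) / (g * e) + 1 / a) * R1 = R1 / e - f / e * (R1 / g) + R1 / a"
      using p by (simp add: field_simps)
    moreover have "(R2 + b * Q) / b \<le> (b * T + i * (S + U)) / b"
      using le'(5) p by (intro divide_right_mono) auto
    then have "R2 / b + Q \<le> T + i / b * (S + U)"
      using p by (simp add: add_divide_distrib)
    ultimately show ?thesis using q T by simp
  qed
  have "\<epsilon> 1 {3} - \<epsilon> 1 {2, 3} = a - c" "\<epsilon> 1 {3, 4} - \<epsilon> 1 {2, 3, 4} = g - f"
    by (simp_all add: ab)
  then show ?thesis
    using 1 2 3 nn unfolding outer_region_def mem_Collect_eq case_prod_conv
    by (intro conjI exI[of _ G] exI[of _ S] exI[of _ U]) (simp_all only: ab[symmetric])
qed

lemma msg_len_asymp: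
  assumes "0 \<le> R"
  shows "(\<lambda>n. msg_len (Suc n) R / Suc n) \<longlonglongrightarrow> R"
proof (rule tendsto_sandwich)
  have "real (msg_len (Suc n) R) = \<lceil>Suc n * R\<rceil>" for n
    using assms by (simp add: msg_len_def)
  then have *: "Suc n * R \<le> msg_len (Suc n) R \<and> msg_len (Suc n) R \<le> Suc n * R + 1" for n
    using ceiling_correct[of "Suc n * R"] by (metis diff_le_eq less_imp_le)
  show "\<forall>\<^sub>F n in sequentially. R \<le> msg_len (Suc n) R / Suc n"
    using * by (auto simp: field_simps intro!: always_eventually)
  have "msg_len (Suc n) R / Suc n \<le> R + inverse (Suc n)" for n
  proof -
    have "msg_len (Suc n) R / Suc n \<le> (Suc n * R + 1) / Suc n"
      using * by (intro divide_right_mono) auto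
    also have "\<dots> = R + inverse (Suc n)"
      by (simp add: add_divide_distrib inverse_eq_divide del: of_nat_Suc)
    finally show ?thesis .
  qed
  then show "\<forall>\<^sub>F n in sequentially. msg_len (Suc n) R / Suc n \<le> R + inverse (Suc n)"
    by (intro always_eventually allI)
  show "(\<lambda>n. R + inverse (Suc n)) \<longlonglongrightarrow> R"
    using tendsto_add[OF tendsto_const LIMSEQ_inverse_real_of_nat] by simp
qed simp

context coded_network
begin

text \<open>All totals lie between 0 and \<open>n\<close>, so division by \<open>n\<close> puts them
  into the unit cube, and the Fano terms become the slack parameters.\<close>

lemma normalized_constraints:
  assumes n: "0 < n"
  shows "\<exists>x \<in> {0..1} \<times> {0..1} \<times> {0..1} \<times> {0..1} \<times> {0..1} \<times> {0..1} \<times> {0..1} \<times> {0..1}.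
    ((L1 / n, L2 / n, inverse n + mean err * (L1 / n), inverse n + mean err * (L2 / n)), x) \<in> constraints \<epsilon>"
proof -
  define m where "m = inverse (real n)"
  have m: "0 < m" "m * n = 1"
    using n by (auto simp: m_def)
  have scale: "x * m \<le> y * m" if "x \<le> y" for x y
    using m that by (intro mult_right_mono) auto
  note b = code_bounds
  have le_n: "total_mean (\<lambda>z. new z {2, 3}) \<le> n" "total_mean gain \<le> n" "total_mean side \<le> n"
    "total_mean useless \<le> n" "total_mean (\<lambda>z t. of_bool (active c z t = 2)) \<le> n"
    using b(1-6) by linarith+
  have unit: "0 \<le> x * m \<and> x * m \<le> 1" if "0 \<le> x" "x \<le> n" for x :: real
    using that m scale[of x n] by (simp add: mult.commute)
  show ?thesis
    unfolding divide_inverse m_def[symmetric]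
  proof (rule bexI[of _ "(total_mean (\<lambda>z. new z {2, 3}) * m, total_mean (\<lambda>z. new z {2, 3, 4}) * m,
      total_mean gain * m, total_mean side * m, total_mean useless * m,
      total_mean (\<lambda>z t. of_bool (active c z t = 2)) * m, total_mean (sends 2 {3, 4} fst) * m,
      total_mean (sends 2 {3, 4} snd) * m)"])
    show "((L1 * m, L2 * m, m + mean err * (L1 * m), m + mean err * (L2 * m)),
        (total_mean (\<lambda>z. new z {2, 3}) * m, total_mean (\<lambda>z. new z {2, 3, 4}) * m,
        total_mean gain * m, total_mean side * m, total_mean useless * m,
        total_mean (\<lambda>z t. of_bool (active c z t = 2)) * m, total_mean (sends 2 {3, 4} fst) * m,
        total_mean (sends 2 {3, 4} snd) * m)) \<in> constraints \<epsilon>"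
      using arg_cong[OF b(1), of "\<lambda>x. x * m"] m(2) b(13-)[THEN scale]
      unfolding constraints_def mem_Collect_eq case_prod_conv distrib_right mult_1 mult.assoc
        by (simp add: mult.commute)
  qed (use b le_n unit in simp)
qed

end

theorem theorem2:
  fixes M :: "'w measure"
    and Z :: "nat \<Rightarrow> nat \<Rightarrow> nat \<Rightarrow> 'w \<Rightarrow> bool"
    and \<epsilon> :: "nat \<Rightarrow> nat set \<Rightarrow> real"
    and R1 R2 :: real
  assumes "erasure_network M Z \<epsilon>"
    and "\<epsilon> 1 {2,3} < 1" and "\<epsilon> 2 {3} < 1" and "\<epsilon> 2 {4} < 1"
    and "\<epsilon> 1 {3} \<ge> \<epsilon> 2 {3}"
    and "achievable TYPE('f::{finite, field}) M Z R1 R2"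
  shows "(R1, R2) \<in> outer_region \<epsilon>"
proof -
  interpret erasure_network M Z \<epsilon> by fact
  let ?B = "{0..1} \<times> {0..1} \<times> {0..1} \<times> {0..1} \<times> {0..1} \<times> {0..1} \<times> {0..1} \<times> {0..1} ::
    (real \<times> real \<times> real \<times> real \<times> real \<times> real \<times> real \<times> real) set"
  have R: "0 \<le> R1" "0 \<le> R2"
    using assms(6) by (auto simp: achievable_def)
  obtain C :: "nat \<Rightarrow> 'f code" where C: "\<And>n. is_code n R1 (C n)"
    and err: "(\<lambda>n. error_prob M Z n R1 R2 (C n)) \<longlonglongrightarrow> 0"
    using assms(6) by (auto simp: achievable_def)
  define p where "p n = error_prob M Z n R1 R2 (C n)" for n
  \<comment> \<open>The shift to block length \<open>Suc n\<close> keeps every denominator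
    positive.\<close>
  define a1 a2 where "a1 n = msg_len (Suc n) R1 / Suc n" and "a2 n = msg_len (Suc n) R2 / Suc n" for n
  define r where "r n = (a1 n, a2 n, inverse (Suc n) + p (Suc n) * a1 n, inverse (Suc n) + p (Suc n) * a2 n)" for n
  have "\<exists>x\<in>?B. (r n, x) \<in> constraints \<epsilon>" for n
  proof -
    interpret coded_network M Z \<epsilon> "C (Suc n)" "Suc n" "msg_len (Suc n) R1" "msg_len (Suc n) R2"
      using C[of "Suc n"] by unfold_locales (auto simp: is_code_def)
    show ?thesis
      using normalized_constraints mean_err[OF refl refl] by (simp add: r_def a1_def a2_def p_def)
  qed
  then obtain x where x: "\<And>n. x n \<in> ?B" "\<And>n. (r n, x n) \<in> constraints \<epsilon>"
    by metis
  have lim: "a1 \<longlonglongrightarrow> R1" "a2 \<longlonglongrightarrow> R2" "(\<lambda>n. p (Suc n)) \<longlonglongrightarrow> 0"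
    unfolding a1_def a2_def p_def by (rule msg_len_asymp[OF R(1)] msg_len_asymp[OF R(2)] LIMSEQ_Suc[OF err])+
  \<comment> \<open>The slacks vanish because the error probability tends to 0 while the normalized
    message lengths stay bounded.\<close>
  have "r \<longlonglongrightarrow> (R1, R2, 0 + 0 * R1, 0 + 0 * R2)"
    unfolding r_def by (intro tendsto_intros lim LIMSEQ_inverse_real_of_nat)
  then have "\<exists>l\<in>?B. ((R1, R2, 0 + 0 * R1, 0 + 0 * R2), l) \<in> constraints \<epsilon>"
    by (rule constraints_limit[OF x])
  then obtain l where l: "l \<in> ?B" "((R1, R2, 0, 0), l) \<in> constraints \<epsilon>"
    unfolding mult_zero_left add_0 by (rule bexE)
  obtain N N' G S U T y where y: "l = (N, N', G, S, U, T, y)"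
    by (rule prod_cases7)
  obtain P Q where PQ: "y = (P, Q)"
    by (rule prod.exhaust)
  have nn: "0 \<le> G" "0 \<le> S" "0 \<le> U"
    using l(1) unfolding y by simp_all
  \<comment> \<open>Monotonicity passes the strict bounds on to the larger receiver sets, whose
    factors also occur as denominators.\<close>
  have "\<epsilon> 1 {2, 3, 4} \<le> \<epsilon> 1 {2, 3}" "\<epsilon> 2 {3, 4} \<le> \<epsilon> 2 {3}" "\<epsilon> 1 {3, 4} \<le> 1"
    using erasure_prob[of 1 1 "{3, 4}"] by (auto intro!: eps_antimono simp: nbrs_def)
  then show ?thesis
    using R nn assms(2-4) by (intro outer_region_if_constraints[OF l(2)[unfolded y PQ]]) auto
qed

end
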